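(* Let $\mathcal V$ be a normed $\mathcal R$-module and let $\mathsf N$ be a local vector measure defined on $\mathcal V$. Then $\mathsf N$ admits a polar decomposition $\mathsf N=L_{\mathsf N}|\mathsf N|$, which is weakly unique (any two polar decompositions $L_{\mathsf N}|\mathsf N|$, $L'_{\mathsf N}|\mathsf N|$ of $\mathsf N$ satisfy, for every $v\in\mathcal V$, $L_{\mathsf N}(v)=L'_{\mathsf N}(v)$ $|\mathsf N|$-a.e.), and $L_{\mathsf N}$ satisfies $$L_{\mathsf N}(v)=\frac{\mathrm d(v\cdot\mathsf N)}{\mathrm d|\mathsf N|}\quad|\mathsf N|\text{-a.e., for every }v\in\mathcal V .$$ Moreover, $$|\mathsf N|\text{-}\operatorname*{ess\,sup}_{v\in\mathcal V,\ \|v\|\le1}L_{\mathsf N}(v)=1\quad |\mathsf N|\text{-a.e.}$$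
   Context: $(X,\tau)$ is a Polish space, $\mathcal B(X)$ its Borel $\sigma$-algebra, $C_b(X)$ the ring of bounded continuous real functions on $X$ with the sup norm $\|\cdot\|_\infty$. A subring $\mathcal R\subseteq C_b(X)$ (containing the unity) approximates open sets if it is a lattice, is closed under multiplication by constants, and for every open $A\subseteq X$ there is a sequence $\{f_k\}_k\subseteq\mathcal R$ with $f_k(x)\nearrow\chi_A(x)$ for every $x\in X$. A normed $\mathcal R$-module (where $\mathcal R$ is always assumed to approximate open sets) is a normed real vector space $(\mathcal V,\|\cdot\|)$ that is also a module over the ring $\mathcal R$ in the algebraic sense and satisfies $\|f_1v_1+\dots+f_nv_n\|\le\max_i\|f_i\|_\infty\max_i\|v_i\|$ whenever $v_1,\dots,v_n\in\mathcal V$ and $f_1,\dots,f_n\in\mathcal R$ have pairwise disjoint supports. For $A\subseteq X$ open and $v\in\mathcal V$ set $\|v\|_{|A}:=\sup\{\|fv\|:f\in\mathcal R,\ \operatorname{supp}f\subseteq A,\ \|f\|_\infty\le1\}$; the germ seminorm is $|v|_g(x):=\inf_A\|v\|_{|A}$, the infimum over all open neighbourhoods $A$ of $x$. $(\mathcal V',\|\cdot\|')$ is the dual normed space of $\mathcal V$. A $\mathcal V'$-valued measure is a map $\mathsf N:\mathcal B(X)\to\mathcal V'$ that is $\sigma$-additive, with convergence of the series in the norm of $\mathcal V'$. A local vector measure defined on $\mathcal V$ is a $\mathcal V'$-valued measure that is weakly local: $\mathsf N(A)(v)=0$ for every $A\subseteq X$ open and $v\in\mathcal V$ with $\|v\|_{|A}=0$.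 The total variation of $\mathsf N$ is the Borel measure $|\mathsf N|(E):=\sup_\pi\sum_{A\in\pi}\|\mathsf N(A)\|'$, the supremum being over all finite Borel partitions $\pi$ of $E$; it is finite for local vector measures. For $v\in\mathcal V$, $v\cdot\mathsf N$ is the finite signed Borel measure $B\mapsto\mathsf N(B)(v)$. $\mathsf N$ admits a polar decomposition if there is a weakly$^*$ $|\mathsf N|$-measurable map $L_{\mathsf N}:X\to\mathcal V'$ (i.e. $x\mapsto L_{\mathsf N}(x)(v)$, denoted $L_{\mathsf N}(v)$, is $|\mathsf N|$-measurable for every $v$) such that for every $v\in\mathcal V$ one has $L_{\mathsf N}(v)\in L^1(|\mathsf N|)$ and $\mathsf N(A)(v)=\int_AL_{\mathsf N}(v)\,\mathrm d|\mathsf N|$ for every Borel $A\subseteq X$, and such that for every $x\in X$, $|L_{\mathsf N}(x)(v)|\le|v|_g(x)$ for every $v\in\mathcal V$. One then writes $\mathsf N=L_{\mathsf N}|\mathsf N|$. The essential supremum $\mu\text{-}\operatorname{ess\,sup}_\alpha f_\alpha$ of a family of $\mu$-measurable functions is the $\mu$-a.e. unique $\mu$-measurable function $g$ with $f_\alpha\le g$ $\mu$-a.e. for all $\alpha$ and $g\le h$ $\mu$-a.e. for every measurable $h$ with $f_\alpha\le h$ $\mu$-a.e. for all $\alpha$. *)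

theory Defs
  imports "HOL-Analysis.Analysis"
begin

section \<open>Rings of bounded continuous functions\<close>

text \<open>The type of bounded continuous functions carries its sup norm and vector space structure in
  the library, but no pointwise products, maxima or minima.\<close>

setup_lifting type_definition_bcontfun

lift_definition bcontfun_mult ::
  "('a::topological_space \<Rightarrow>\<^sub>C real) \<Rightarrow> ('a \<Rightarrow>\<^sub>C real) \<Rightarrow> ('a \<Rightarrow>\<^sub>C real)" is "\<lambda>f g x. f x * g x"
proof -
  fix f g :: "'a \<Rightarrow> real" assume "f \<in> bcontfun" "g \<in> bcontfun"
  then obtain a b where "continuous_on UNIV f" "continuous_on UNIV g"
    and ab: "\<And>x. \<bar>f x\<bar> \<le> a" "\<And>x. \<bar>g x\<bar> \<le> b"
    unfolding bcontfun_def by (auto simp: bounded_iff)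
  moreover have "\<bar>f x * g x\<bar> \<le> a * b" for x
    unfolding abs_mult using ab[of x] by (intro mult_mono) auto
  ultimately show "(\<lambda>x. f x * g x) \<in> bcontfun"
    unfolding bcontfun_def by (auto simp: bounded_iff intro!: continuous_intros)
qed

lift_definition bcontfun_max ::
  "('a::topological_space \<Rightarrow>\<^sub>C real) \<Rightarrow> ('a \<Rightarrow>\<^sub>C real) \<Rightarrow> ('a \<Rightarrow>\<^sub>C real)" is "\<lambda>f g x. max (f x) (g x)"
proof -
  fix f g :: "'a \<Rightarrow> real" assume "f \<in> bcontfun" "g \<in> bcontfun"
  then obtain a b where "continuous_on UNIV f" "continuous_on UNIV g"
    and ab: "\<And>x. \<bar>f x\<bar> \<le> a" "\<And>x. \<bar>g x\<bar> \<le> b"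
    unfolding bcontfun_def by (auto simp: bounded_iff)
  moreover have "\<bar>max (f x) (g x)\<bar> \<le> max a b" for x
    using ab[of x] by linarith
  ultimately show "(\<lambda>x. max (f x) (g x)) \<in> bcontfun"
    unfolding bcontfun_def bounded_iff by (auto intro!: continuous_intros)
qed

lift_definition bcontfun_min ::
  "('a::topological_space \<Rightarrow>\<^sub>C real) \<Rightarrow> ('a \<Rightarrow>\<^sub>C real) \<Rightarrow> ('a \<Rightarrow>\<^sub>C real)" is "\<lambda>f g x. min (f x) (g x)"
proof -
  fix f g :: "'a \<Rightarrow> real" assume "f \<in> bcontfun" "g \<in> bcontfun"
  then obtain a b where "continuous_on UNIV f" "continuous_on UNIV g"
    and ab: "\<And>x. \<bar>f x\<bar> \<le> a" "\<And>x. \<bar>g x\<bar> \<le> b"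
    unfolding bcontfun_def by (auto simp: bounded_iff)
  moreover have "\<bar>min (f x) (g x)\<bar> \<le> max a b" for x
    using ab[of x] by linarith
  ultimately show "(\<lambda>x. min (f x) (g x)) \<in> bcontfun"
    unfolding bcontfun_def bounded_iff by (auto intro!: continuous_intros)
qed

definition bcontfun_supp :: "('a::topological_space \<Rightarrow>\<^sub>C real) \<Rightarrow> 'a set" where
  "bcontfun_supp f = closure {x. f x \<noteq> 0}"

definition bcontfun_subring :: "('a::topological_space \<Rightarrow>\<^sub>C real) set \<Rightarrow> bool" where
  "bcontfun_subring R \<longleftrightarrow>
     const_bcontfun 1 \<in> R \<and>
     (\<forall>f\<in>R. \<forall>g\<in>R. f + g \<in> R \<and> - f \<in> R \<and> bcontfun_mult f g \<in> R)"

definition approximates_open_sets :: "('a::topological_space \<Rightarrow>\<^sub>C real) set \<Rightarrow> bool" where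
  "approximates_open_sets R \<longleftrightarrow>
     bcontfun_subring R \<and>
     (\<forall>f\<in>R. \<forall>g\<in>R. bcontfun_max f g \<in> R \<and> bcontfun_min f g \<in> R) \<and>
     (\<forall>c. \<forall>f\<in>R. c *\<^sub>R f \<in> R) \<and>
     (\<forall>A. open A \<longrightarrow> (\<exists>F :: nat \<Rightarrow> 'a \<Rightarrow>\<^sub>C real. range F \<subseteq> R \<and>
        (\<forall>x. incseq (\<lambda>k. F k x) \<and> (\<lambda>k. F k x) \<longlonglongrightarrow> indicator A x)))"

section \<open>Normed modules\<close>

text \<open>The module is the whole type \<open>'v\<close>; the values of the action \<open>act f v\<close> for \<open>f\<close> outside \<open>R\<close>
  are irrelevant. Agreement of \<open>act\<close> with \<open>scaleR\<close> on constant functions is not an axiom: by the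
  norm bound, the action of constants is additive and continuous in the constant.\<close>

definition normed_module ::
  "('a::topological_space \<Rightarrow>\<^sub>C real) set \<Rightarrow> (('a \<Rightarrow>\<^sub>C real) \<Rightarrow> 'v::real_normed_vector \<Rightarrow> 'v) \<Rightarrow> bool" where
  "normed_module R act \<longleftrightarrow>
     approximates_open_sets R \<and>
     (\<forall>v. act (const_bcontfun 1) v = v) \<and>
     (\<forall>f\<in>R. \<forall>v w. act f (v + w) = act f v + act f w) \<and>
     (\<forall>f\<in>R. \<forall>g\<in>R. \<forall>v. act (f + g) v = act f v + act g v) \<and>
     (\<forall>f\<in>R. \<forall>g\<in>R. \<forall>v. act (bcontfun_mult f g) v = act f (act g v)) \<and>
     (\<forall>n::nat. \<forall>f v. n \<ge> 1 \<longrightarrow> (\<forall>i<n. f i \<in> R) \<longrightarrow>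
        disjoint_family_on (\<lambda>i. bcontfun_supp (f i)) {..<n} \<longrightarrow>
        norm (\<Sum>i<n. act (f i) (v i)) \<le> (MAX i\<in>{..<n}. norm (f i)) * (MAX i\<in>{..<n}. norm (v i)))"

definition local_seminorm ::
  "('a::topological_space \<Rightarrow>\<^sub>C real) set \<Rightarrow> (('a \<Rightarrow>\<^sub>C real) \<Rightarrow> 'v::real_normed_vector \<Rightarrow> 'v) \<Rightarrow>
   'a set \<Rightarrow> 'v \<Rightarrow> real" where
  "local_seminorm R act A v =
     (SUP f\<in>{f \<in> R. bcontfun_supp f \<subseteq> A \<and> norm f \<le> 1}. norm (act f v))"

definition germ_seminorm ::
  "('a::topological_space \<Rightarrow>\<^sub>C real) set \<Rightarrow> (('a \<Rightarrow>\<^sub>C real) \<Rightarrow> 'v::real_normed_vector \<Rightarrow> 'v) \<Rightarrow>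
   'v \<Rightarrow> 'a \<Rightarrow> real" where
  "germ_seminorm R act v x = (INF A\<in>{A. open A \<and> x \<in> A}. local_seminorm R act A v)"

section \<open>Local vector measures\<close>

text \<open>Only the values on Borel sets matter. Taking all sets of the family empty gives
  \<open>N {} = 0\<close>.\<close>

definition vector_measure :: "('a::topological_space set \<Rightarrow> 'b::real_normed_vector) \<Rightarrow> bool" where
  "vector_measure N \<longleftrightarrow>
     (\<forall>A :: nat \<Rightarrow> 'a set. range A \<subseteq> sets borel \<longrightarrow> disjoint_family A \<longrightarrow>
        (\<lambda>i. N (A i)) sums N (\<Union>i. A i))"

definition local_vector_measure ::
  "('a::topological_space \<Rightarrow>\<^sub>C real) set \<Rightarrow> (('a \<Rightarrow>\<^sub>C real) \<Rightarrow> 'v::real_normed_vector \<Rightarrow> 'v) \<Rightarrow>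
   ('a set \<Rightarrow> 'v \<Rightarrow>\<^sub>L real) \<Rightarrow> bool" where
  "local_vector_measure R act N \<longleftrightarrow>
     vector_measure N \<and>
     (\<forall>A v. open A \<longrightarrow> local_seminorm R act A v = 0 \<longrightarrow> N A v = 0)"

definition variation :: "('a::topological_space set \<Rightarrow> 'b::real_normed_vector) \<Rightarrow> 'a set \<Rightarrow> ennreal" where
  "variation N E =
     (SUP P\<in>{P. finite P \<and> P \<subseteq> sets borel \<and> partition_on E P}. \<Sum>A\<in>P. ennreal (norm (N A)))"

definition total_variation :: "('a::topological_space set \<Rightarrow> 'b::real_normed_vector) \<Rightarrow> 'a measure" where
  "total_variation N = measure_of UNIV (sets borel) (variation N)"

lemma sets_total_variation [simp, measurable_cong]: "sets (total_variation N) = sets borel"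
  unfolding total_variation_def by (metis sets.sets_measure_of_eq space_borel)

lemma space_total_variation [simp]: "space (total_variation N) = UNIV"
  unfolding total_variation_def by (simp add: space_measure_of_conv)

lemma vector_measure_empty:
  assumes "vector_measure N" shows "N {} = 0"
proof -
  have "(\<lambda>i::nat. N {}) sums N (\<Union>i::nat. {})"
    using assms unfolding vector_measure_def disjoint_family_on_def by auto
  then have "(\<lambda>i::nat. N {}) \<longlonglongrightarrow> 0"
    using sums_summable summable_LIMSEQ_zero by blast
  then show ?thesis by (simp add: LIMSEQ_const_iff)
qed

lemma variation_mono:
  assumes "A \<subseteq> B" "A \<in> sets borel" "B \<in> sets borel"
  shows "variation N A \<le> variation N B"
  unfolding variation_def
proof (rule SUP_mono)
  fix P assume P: "P \<in> {P. finite P \<and> P \<subseteq> sets borel \<and> partition_on A P}"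
  let ?Q = "if B - A = {} then P else insert (B - A) P"
  have "?Q \<in> {P. finite P \<and> P \<subseteq> sets borel \<and> partition_on B P}"
    using P assms unfolding partition_on_def disjoint_def
    by (auto split: if_splits)
  moreover have "(\<Sum>A\<in>P. ennreal (norm (N A))) \<le> (\<Sum>A\<in>?Q. ennreal (norm (N A)))"
    using P by (intro sum_mono2) auto
  ultimately show "\<exists>Q\<in>{P. finite P \<and> P \<subseteq> sets borel \<and> partition_on B P}.
      (\<Sum>A\<in>P. ennreal (norm (N A))) \<le> (\<Sum>A\<in>Q. ennreal (norm (N A)))"
    by blast
qed

lemma finite_borel_partition_exists:
  assumes "A \<in> sets borel"
  shows "{P. finite P \<and> P \<subseteq> sets borel \<and> partition_on A P} \<noteq> {}"
proof -
  have "(if A = {} then {} else {A}) \<in> {P. finite P \<and> P \<subseteq> sets borel \<and> partition_on A P}"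
    using assms by (auto simp: partition_on_def disjoint_def)
  then show ?thesis by blast
qed

lemma variation_superadditive:
  assumes "A \<inter> B = {}" "A \<in> sets borel" "B \<in> sets borel"
  shows "variation N A + variation N B \<le> variation N (A \<union> B)"
proof -
  let ?S = "\<lambda>P. \<Sum>A\<in>P. ennreal (norm (N A))"
  let ?Pt = "\<lambda>E. {P. finite P \<and> P \<subseteq> sets borel \<and> partition_on E P}"
  have *: "?S P + ?S Q \<le> variation N (A \<union> B)" if P: "P \<in> ?Pt A" and Q: "Q \<in> ?Pt B" for P Q
  proof -
    have "P \<inter> Q = {}"
    proof -
      have "C = {}" if "C \<in> P" "C \<in> Q" for C
      proof -
        have "C \<subseteq> A" "C \<subseteq> B" using that P Q unfolding partition_on_def by blast+
        then show ?thesis using assms(1) by blast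
      qed
      then show ?thesis using P unfolding partition_on_def by blast
    qed
    then have "?S P + ?S Q = ?S (P \<union> Q)"
      using P Q by (simp add: sum.union_disjoint del: sum_ennreal)
    moreover have "P \<union> Q \<in> ?Pt (A \<union> B)"
    proof -
      have "C \<inter> D = {}" if "C \<in> P" "D \<in> Q" for C D
        using that P Q assms(1) unfolding partition_on_def by blast
      then have "disjoint (P \<union> Q)"
        using P Q unfolding partition_on_def by (intro disjoint_union) auto
      then show ?thesis
        using P Q unfolding partition_on_def by auto
    qed
    ultimately show ?thesis
      unfolding variation_def by (simp only: SUP_upper)
  qed
  have **: "variation N A + ?S Q \<le> variation N (A \<union> B)" if Q: "Q \<in> ?Pt B" for Q
  proof -
    have "variation N A + ?S Q = (SUP P\<in>?Pt A. ?S P + ?S Q)"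
      unfolding variation_def[of N A]
      by (rule ennreal_SUP_add_left[symmetric]) (rule finite_borel_partition_exists[OF assms(2)])
    also have "\<dots> \<le> variation N (A \<union> B)"
      by (rule SUP_least) (rule *[OF _ Q])
    finally show ?thesis .
  qed
  have "variation N A + variation N B = (SUP Q\<in>?Pt B. variation N A + ?S Q)"
    unfolding variation_def[of N B]
    by (rule ennreal_SUP_add_right) (rule finite_borel_partition_exists[OF assms(3)])
  also have "\<dots> \<le> variation N (A \<union> B)"
    by (rule SUP_least) (rule **)
  finally show ?thesis .
qed

text \<open>\<open>measure_of\<close> would silently return the zero measure if \<open>variation N\<close> were not a measure.\<close>

lemma emeasure_total_variation:
  assumes N: "vector_measure N" and E: "E \<in> sets borel"
  shows "emeasure (total_variation N) E = variation N E"
proof (rule emeasure_measure_of)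
  show "total_variation N = measure_of UNIV (sets borel) (variation N)"
    by (rule total_variation_def)
  show "positive (sets (total_variation N)) (variation N)"
  proof -
    have "{P. finite P \<and> P \<subseteq> sets borel \<and> partition_on {} P} = {{} :: 'a set set}"
      by (auto simp: partition_on_def)
    then show ?thesis by (auto simp: positive_def variation_def)
  qed
  show "countably_additive (sets (total_variation N)) (variation N)"
    unfolding countably_additive_def sets_total_variation
  proof (intro allI impI)
    fix A :: "nat \<Rightarrow> 'a set"
    assume A: "range A \<subseteq> sets borel" "disjoint_family A" and "(\<Union>i. A i) \<in> sets borel"
    have Ai [measurable]: "A i \<in> sets borel" for i using A by auto
    have U: "(\<Union>i\<in>I. A i) \<in> sets borel" for I by (rule sets.countable_UN'') auto
    have dj: "x \<notin> A j" if "x \<in> A i" "i \<noteq> j" for x i j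
      using A(2) that unfolding disjoint_family_on_def by blast
    have fin: "(\<Sum>i<n. variation N (A i)) \<le> variation N (\<Union>i<n. A i)" for n
    proof (induction n)
      case (Suc n)
      have "(\<Sum>i<Suc n. variation N (A i)) \<le> variation N (\<Union>i<n. A i) + variation N (A n)"
        using Suc by (simp add: add_right_mono)
      also have "\<dots> \<le> variation N ((\<Union>i<n. A i) \<union> A n)"
      proof (rule variation_superadditive)
        show "(\<Union>i<n. A i) \<inter> A n = {}"
          using dj by (auto dest: less_imp_neq)
      qed (use U Ai in blast)+
      finally show ?case by (simp add: lessThan_Suc Un_commute)
    qed simp
    show "(\<Sum>i. variation N (A i)) = variation N (\<Union>i. A i)"
    proof (rule antisym)
      show "(\<Sum>i. variation N (A i)) \<le> variation N (\<Union>i. A i)"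
      proof (rule suminf_le_const)
        show "(\<Sum>i<n. variation N (A i)) \<le> variation N (\<Union>i. A i)" for n
          by (rule order.trans[OF fin variation_mono]) (use U in blast)+
      qed simp
      show "variation N (\<Union>i. A i) \<le> (\<Sum>i. variation N (A i))"
        unfolding variation_def[of N "\<Union>i. A i"]
      proof (rule SUP_least)
        fix P assume P: "P \<in> {P. finite P \<and> P \<subseteq> sets borel \<and> partition_on (\<Union>i. A i) P}"
        have le: "ennreal (norm (N C)) \<le> (\<Sum>i. ennreal (norm (N (C \<inter> A i))))" if C: "C \<in> P" for C
        proof -
          have "(\<lambda>i. N (C \<inter> A i)) sums N (\<Union>i. C \<inter> A i)"
          proof (rule N[unfolded vector_measure_def, rule_format])
            show "range (\<lambda>i. C \<inter> A i) \<subseteq> sets borel"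
              using C P by (auto intro!: sets.Int Ai)
            show "disjoint_family (\<lambda>i. C \<inter> A i)"
              using dj unfolding disjoint_family_on_def by blast
          qed
          also have "(\<Union>i. C \<inter> A i) = C"
            using C P unfolding partition_on_def by auto
          finally have "(\<lambda>n. ennreal (norm (\<Sum>i<n. N (C \<inter> A i)))) \<longlonglongrightarrow> ennreal (norm (N C))"
            unfolding sums_def by (intro tendsto_ennrealI tendsto_norm)
          moreover have "ennreal (norm (\<Sum>i<n. N (C \<inter> A i))) \<le> (\<Sum>i. ennreal (norm (N (C \<inter> A i))))"
            for n
          proof -
            have "ennreal (norm (\<Sum>i<n. N (C \<inter> A i))) \<le> ennreal (\<Sum>i<n. norm (N (C \<inter> A i)))"
              by (intro ennreal_leI norm_sum)
            also have "\<dots> = (\<Sum>i<n. ennreal (norm (N (C \<inter> A i))))"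
              by (simp add: sum_ennreal)
            also have "\<dots> \<le> (\<Sum>i. ennreal (norm (N (C \<inter> A i))))"
              by (intro sum_le_suminf) auto
            finally show ?thesis .
          qed
          ultimately show ?thesis by (meson LIMSEQ_le_const2)
        qed
        have "(\<Sum>C\<in>P. ennreal (norm (N C))) \<le> (\<Sum>C\<in>P. \<Sum>i. ennreal (norm (N (C \<inter> A i))))"
          by (intro sum_mono le)
        also have "\<dots> = (\<Sum>i. \<Sum>C\<in>P. ennreal (norm (N (C \<inter> A i))))"
          by (rule suminf_sum[symmetric]) simp
        also have "\<dots> \<le> (\<Sum>i. variation N (A i))"
        proof (intro suminf_le)
          fix i
          let ?P = "{C \<in> P. C \<inter> A i \<noteq> {}}"
          have "(\<Sum>C\<in>P. ennreal (norm (N (C \<inter> A i)))) = (\<Sum>C\<in>?P. ennreal (norm (N (C \<inter> A i))))"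
            using P by (intro sum.mono_neutral_right) (auto simp: vector_measure_empty[OF N])
          also have "\<dots> = (\<Sum>C\<in>(\<lambda>C. C \<inter> A i) ` ?P. ennreal (norm (N C)))"
          proof (subst sum.reindex)
            show "inj_on (\<lambda>C. C \<inter> A i) ?P"
            proof (rule inj_onI, rule ccontr)
              fix C D assume CD: "C \<in> ?P" "D \<in> ?P" "C \<inter> A i = D \<inter> A i" "C \<noteq> D"
              then have "C \<inter> D = {}" using P unfolding partition_on_def disjoint_def by auto
              with CD show False by auto
            qed
          qed simp
          also have "\<dots> \<le> variation N (A i)"
            unfolding variation_def
          proof (rule SUP_upper, intro CollectI conjI)
            show "finite ((\<lambda>C. C \<inter> A i) ` ?P)" using P by auto
            show "(\<lambda>C. C \<inter> A i) ` ?P \<subseteq> sets borel" using P by auto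
            show "partition_on (A i) ((\<lambda>C. C \<inter> A i) ` ?P)"
            proof (rule partition_onI)
              show "\<Union> ((\<lambda>C. C \<inter> A i) ` ?P) = A i"
                using P unfolding partition_on_def by blast
              fix p q assume "p \<in> (\<lambda>C. C \<inter> A i) ` ?P" "q \<in> (\<lambda>C. C \<inter> A i) ` ?P" "p \<noteq> q"
              then obtain C D where "C \<in> P" "D \<in> P" "C \<noteq> D" "p = C \<inter> A i" "q = D \<inter> A i"
                by auto
              moreover from this have "C \<inter> D = {}"
                using P unfolding partition_on_def disjoint_def by auto
              ultimately show "disjnt p q"
                unfolding disjnt_def by blast
            qed auto
          qed
          finally show "(\<Sum>C\<in>P. ennreal (norm (N (C \<inter> A i)))) \<le> variation N (A i)" .
        qed auto
        finally show "(\<Sum>C\<in>P. ennreal (norm (N C))) \<le> (\<Sum>i. variation N (A i))" .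
      qed
    qed
  qed
qed (use E in auto)

section \<open>Polar decompositions\<close>

text \<open>Here \<open>\<mu>\<close>-measurable means measurable with respect to the \<open>\<mu>\<close>-completion of the Borel
  \<open>\<sigma>\<close>-algebra.\<close>

definition polar_decomposition ::
  "('a::topological_space \<Rightarrow>\<^sub>C real) set \<Rightarrow> (('a \<Rightarrow>\<^sub>C real) \<Rightarrow> 'v::real_normed_vector \<Rightarrow> 'v) \<Rightarrow>
   ('a set \<Rightarrow> 'v \<Rightarrow>\<^sub>L real) \<Rightarrow> ('a \<Rightarrow> 'v \<Rightarrow>\<^sub>L real) \<Rightarrow> bool" where
  "polar_decomposition R act N L \<longleftrightarrow>
     (\<forall>v. (\<lambda>x. L x v) \<in> borel_measurable (completion (total_variation N))) \<and>
     (\<forall>v. integrable (completion (total_variation N)) (\<lambda>x. L x v) \<and>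
          (\<forall>A\<in>sets borel. N A v = (LINT x:A|completion (total_variation N). L x v))) \<and>
     (\<forall>x v. \<bar>L x v\<bar> \<le> germ_seminorm R act v x)"

text \<open>The library's \<open>RN_deriv\<close> only covers nonnegative measures. As there, a representative is
  chosen; it is unique up to null sets whenever it exists.\<close>

definition signed_RN_deriv :: "'a measure \<Rightarrow> ('a set \<Rightarrow> real) \<Rightarrow> 'a \<Rightarrow> real" where
  "signed_RN_deriv M \<nu> =
     (SOME f. integrable M f \<and> (\<forall>B\<in>sets M. \<nu> B = (LINT x:B|M. f x)))"

definition is_ess_sup ::
  "'a measure \<Rightarrow> 'i set \<Rightarrow> ('i \<Rightarrow> 'a \<Rightarrow> ereal) \<Rightarrow> ('a \<Rightarrow> ereal) \<Rightarrow> bool" where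
  "is_ess_sup M I f g \<longleftrightarrow>
     g \<in> borel_measurable (completion M) \<and>
     (\<forall>i\<in>I. AE x in M. f i x \<le> g x) \<and>
     (\<forall>h\<in>borel_measurable (completion M). (\<forall>i\<in>I. AE x in M. f i x \<le> h x) \<longrightarrow> (AE x in M. g x \<le> h x))"

end

theory Submission
  imports Defs
begin

text \<open>
  The variation of \<open>N\<close> is finite because near-optimal unit vectors for the pieces of a finite
  partition can be glued, by cutoffs in \<open>R\<close> with disjoint supports, into a single vector of norm at
  most \<open>1\<close>; so the variation is bounded by the supremum of the norms \<open>\<parallel>N(B)\<parallel>\<close>, which is finite by
  \<open>\<sigma>\<close>-additivity alone. Replacing \<open>v\<close> by a cutoff times \<open>v\<close> also shows \<open>\<bar>N(B)(v)\<bar> \<le> |N|(B) \<parallel>v\<parallel>\<^sub>A\<close>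
  for \<open>B\<close> inside an open set \<open>A\<close>.

  The space is cut into refining countable partitions whose cells shrink to points. The quotients
  \<open>N(C)(v) / |N|(C)\<close> over the cells \<open>C\<close> around \<open>x\<close> are linear in \<open>v\<close>, converge for almost every \<open>x\<close> to the
  density of \<open>v\<cdot>N\<close>, and their limit along a fixed ultrafilter exists for every \<open>x\<close>. This limit is
  \<open>L(x)(v)\<close>; the local estimate above gives the bound by the germ seminorm at every point.
  If the essential supremum were below some \<open>r < 1\<close> on a set \<open>E\<close>, then \<open>\<parallel>N(B)\<parallel> \<le> r |N|(B)\<close> for all
  \<open>B \<subseteq> E\<close>, hence \<open>|N|(E) \<le> r |N|(E)\<close> and \<open>E\<close> is null.
\<close>

section \<open>Ultrafilter limits\<close>

text \<open>Zorn's lemma gives a minimal proper filter below \<open>F\<close>; the infimum of a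
  chain is proper because whatever holds eventually in it already does so in some member. Minimality
  decides every \<open>P\<close>: restricting \<open>U\<close> to \<open>P\<close> yields either
  \<open>bot\<close> or \<open>U\<close> itself.\<close>

lemma ultrafilter_exists:
  fixes F :: "'a filter"
  assumes "F \<noteq> bot"
  obtains U where "U \<le> F" "U \<noteq> bot" "\<And>P. eventually P U \<or> eventually (\<lambda>x. \<not> P x) U"
proof -
  define A where "A = {G. G \<le> F \<and> G \<noteq> bot}"
  have po: "partial_order_on A (relation_of (\<ge>) A)"
    by (auto simp: partial_order_on_def preorder_on_def refl_on_def trans_def antisym_def relation_of_def)
  have "\<exists>U\<in>A. \<forall>G\<in>A. U \<ge> G \<longrightarrow> G = U"
  proof (rule predicate_Zorn[OF po])
    fix C assume C: "C \<in> Chains (relation_of (\<ge>) A)"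
    show "\<exists>u\<in>A. \<forall>G\<in>C. G \<ge> u"
    proof (cases "C = {}")
      case True
      then show ?thesis using assms by (auto simp: A_def)
    next
      case False
      have CA: "C \<subseteq> A" using C by (auto simp: Chains_def relation_of_def)
      have "\<exists>x\<in>C. x \<le> inf G H" if "G \<in> C" "H \<in> C" for G H
        using C that unfolding Chains_def relation_of_def by (cases "G \<le> H") auto
      then have "eventually P (Inf C) \<longleftrightarrow> (\<exists>b\<in>C. eventually P b)" for P
        using False by (intro eventually_Inf_base) auto
      from this[of "\<lambda>_. False"] have "Inf C \<noteq> bot"
        using CA by (auto simp: A_def trivial_limit_def)
      moreover have "Inf C \<le> F"
        using False CA by (auto simp: A_def intro: Inf_lower2)
      ultimately show ?thesis
        by (intro bexI[of _ "Inf C"]) (auto simp: A_def intro: Inf_lower)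
    qed
  qed
  then obtain U where U: "U \<in> A" and min: "\<And>G. G \<in> A \<Longrightarrow> G \<le> U \<Longrightarrow> G = U" by auto
  show thesis
  proof (rule that)
    show "U \<le> F" "U \<noteq> bot" using U by (auto simp: A_def)
    show "eventually P U \<or> eventually (\<lambda>x. \<not> P x) U" for P
    proof (cases "inf U (principal {x. P x}) = bot")
      case True
      then show ?thesis
        by (simp add: trivial_limit_def eventually_inf_principal)
    next
      case False
      then have "inf U (principal {x. P x}) = U"
        using \<open>U \<le> F\<close> by (intro min) (auto simp: A_def intro: le_infI1)
      moreover have "eventually P (inf U (principal {x. P x}))"
        by (simp add: eventually_inf_principal)
      ultimately show ?thesis by simp
    qed
  qed
qed

text \<open>Compactness supplies a cluster point \<open>l\<close>. If \<open>f\<close> were not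
  eventually in some neighbourhood of \<open>l\<close>, the ultrafilter would put it eventually
  outside, which a cluster point forbids.\<close>

lemma ultrafilter_tendsto_compact:
  fixes f :: "'a \<Rightarrow> 'b::topological_space"
  assumes "U \<noteq> bot" and ultra: "\<And>P. eventually P U \<or> eventually (\<lambda>x. \<not> P x) U"
    and K: "compact K" and f: "eventually (\<lambda>x. f x \<in> K) U"
  obtains l where "l \<in> K" "(f \<longlongrightarrow> l) U"
proof -
  have "filtermap f U \<noteq> bot" "eventually (\<lambda>x. x \<in> K) (filtermap f U)"
    using assms by (auto simp: filtermap_bot_iff eventually_filtermap)
  with K obtain l where l: "l \<in> K" "inf (nhds l) (filtermap f U) \<noteq> bot"
    unfolding compact_filter by metis
  have "(f \<longlongrightarrow> l) U"
  proof (rule topological_tendstoI, rule ccontr)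
    fix S assume S: "open S" "l \<in> S" "\<not> (\<forall>\<^sub>F x in U. f x \<in> S)"
    then have "eventually (\<lambda>y. y \<notin> S) (filtermap f U)"
      using ultra[of "\<lambda>x. f x \<in> S"] by (simp add: eventually_filtermap)
    moreover have "eventually (\<lambda>y. y \<in> S) (nhds l)"
      using S eventually_nhds by blast
    ultimately have "eventually (\<lambda>_. False) (inf (nhds l) (filtermap f U))"
      unfolding eventually_inf by blast
    then show False using l by (simp add: trivial_limit_def)
  qed
  with l show thesis using that by blast
qed

section \<open>Differentiation along refining partitions\<close>

text \<open>The code of \<open>x\<close> lists, for each \<open>m < n\<close>, the index of the
  first point of a dense sequence closer to \<open>x\<close> than \<open>1 / Suc m\<close>. Longer
  codes extend shorter ones, which makes the partitions refine.\<close>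

lemma refining_partitions_exist:
  obtains c :: "nat \<Rightarrow> 'a::{metric_space, second_countable_topology} \<Rightarrow> nat list"
  where "\<And>n. c n \<in> measurable borel (count_space UNIV)"
    and "\<And>n x. length (c n x) = n"
    and "\<And>m n x y. m \<le> n \<Longrightarrow> c n x = c n y \<Longrightarrow> c m x = c m y"
    and "\<And>x A. open A \<Longrightarrow> x \<in> A \<Longrightarrow> \<forall>\<^sub>F n in sequentially. {y. c n y = c n x} \<subseteq> A"
proof -
  obtain D :: "'a set" where D: "countable D"
    and dense: "\<And>X. open X \<Longrightarrow> X \<noteq> {} \<Longrightarrow> \<exists>d\<in>D. d \<in> X"
    using countable_dense_setE by blast
  have "D \<noteq> {}" using dense[of UNIV] by auto
  define d where "d = from_nat_into D"
  have d: "\<exists>k. dist x (d k) < e" if e: "e > 0" for x e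
  proof -
    obtain z where "z \<in> D" "z \<in> ball x e" using dense[of "ball x e"] e by (metis centre_in_ball empty_iff open_ball)
    then show ?thesis
      using from_nat_into_surj[OF D] by (metis d_def mem_ball)
  qed
  define e where "e m x = (LEAST k. dist x (d k) < 1 / Suc m)" for m x
  have e_dist: "dist x (d (e m x)) < 1 / Suc m" for m x
    unfolding e_def by (rule LeastI_ex, rule d) simp
  have [measurable]: "e m \<in> measurable borel (count_space UNIV)" for m
    unfolding e_def by measurable
  define c where "c n x = map (\<lambda>m. e m x) [0..<n]" for n x
  have len: "length (c n x) = n" for n x by (simp add: c_def)
  have c_iff: "c n x = l \<longleftrightarrow> length l = n \<and> (\<forall>m<n. e m x = l ! m)" for n x l
    by (auto simp: c_def list_eq_iff_nth_eq)
  show thesis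
  proof (rule that)
    show "c n \<in> measurable borel (count_space UNIV)" for n
    proof -
      have "c n -` {l} \<inter> space borel \<in> sets borel" for l
      proof -
        have "Measurable.pred borel (\<lambda>x. length l = n \<and> (\<forall>m<n. e m x = l ! m))"
          by measurable
        then have "{x \<in> space borel. length l = n \<and> (\<forall>m<n. e m x = l ! m)} \<in> sets borel"
          by measurable
        moreover have "c n -` {l} \<inter> space borel
            = {x \<in> space borel. length l = n \<and> (\<forall>m<n. e m x = l ! m)}"
          using c_iff by auto
        ultimately show ?thesis by simp
      qed
      then show ?thesis by (simp add: measurable_count_space_eq2_countable)
    qed
    show "length (c n x) = n" for n x by (rule len)
    show "c m x = c m y" if "m \<le> n" "c n x = c n y" for m n x y
      using that by (auto simp: c_def list_eq_iff_nth_eq)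
    show "\<forall>\<^sub>F n in sequentially. {y. c n y = c n x} \<subseteq> A" if A: "open A" "x \<in> A" for x A
    proof -
      obtain r where r: "r > 0" "ball x r \<subseteq> A" using A open_contains_ball by blast
      \<comment> \<open>Two points closer than \<open>1 / Suc m\<close> to the same dense point are
        less than \<open>r\<close> apart; \<open>Suc m\<close> is the first level whose code
        contains the entry of index \<open>m\<close>.\<close>
      obtain m where m: "1 / real (Suc m) < r / 2"
        using r nat_approx_posE[of "r / 2"] by auto
      have "{y. c n y = c n x} \<subseteq> A" if "n \<ge> Suc m" for n
      proof
        fix y assume "y \<in> {y. c n y = c n x}"
        then have "e m y = e m x" using that by (auto simp: c_def)
        then have "dist x y < r"
          using e_dist[of x m] e_dist[of y m] m dist_triangle2[of x y "d (e m x)"] by simp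
        then show "y \<in> A" using r by auto
      qed
      then show ?thesis using eventually_at_top_linorder by blast
    qed
  qed
qed

lemma integrable_imp_set_integrable:
  fixes f :: "'a \<Rightarrow> 'b::{banach, second_countable_topology}"
  shows "integrable M f \<Longrightarrow> A \<in> sets M \<Longrightarrow> set_integrable M A f"
  unfolding set_integrable_def by (rule integrable_mult_indicator)

text \<open>Finite unions of level sets of \<open>k\<close> have nonnegative integral, and these
  unions increase to \<open>G\<close>.\<close>

lemma set_integral_countable_partition_nonneg:
  fixes f :: "'a \<Rightarrow> real" and k :: "'a \<Rightarrow> 'i::countable"
  assumes [measurable]: "G \<in> sets M" "k \<in> measurable M (count_space UNIV)"
    and int: "set_integrable M G f"
    and nonneg: "\<And>i. 0 \<le> (LINT x:{x \<in> G. k x = i}|M. f x)"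
  shows "0 \<le> (LINT x:G|M. f x)"
proof -
  have G: "G \<subseteq> space M" by (rule sets.sets_into_space) fact
  define B where "B n = {x \<in> G. to_nat (k x) = n}" for n
  have B_eq: "B n = {x \<in> space M. x \<in> G \<and> to_nat (k x) = n}" for n
    unfolding B_def using G by auto
  have B[measurable]: "B n \<in> sets M" for n unfolding B_eq by measurable
  have B_nonneg: "0 \<le> (LINT x:B n|M. f x)" for n
  proof (cases "\<exists>i::'i. to_nat i = n")
    case True
    then obtain i :: 'i where "to_nat i = n" by blast
    then have "B n = {x \<in> G. k x = i}" by (auto simp: B_def)
    then show ?thesis using nonneg by simp
  next
    case False
    then have "B n = {}" by (auto simp: B_def)
    then show ?thesis by (simp add: set_lebesgue_integral_def)
  qed
  have UB: "(\<Union>n. \<Union>j<n. B j) = G" by (auto simp: B_def)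
  have "(\<lambda>n. LINT x:(\<Union>j<n. B j)|M. f x) \<longlonglongrightarrow> (LINT x:(\<Union>n. \<Union>j<n. B j)|M. f x)"
    by (rule set_integral_cont_up) (use int UB in \<open>force simp: incseq_def\<close>)+
  moreover have "0 \<le> (LINT x:(\<Union>j<n. B j)|M. f x)" for n
  proof -
    have "(LINT x:(\<Union>j\<in>{..<n}. B j)|M. f x) = (\<Sum>j<n. LINT x:B j|M. f x)"
      by (rule set_integral_finite_Union)
        (auto simp: disjoint_family_on_def B_def intro!: set_integrable_subset[OF int] B[unfolded B_def])
    then show ?thesis using B_nonneg by (simp add: sum_nonneg)
  qed
  ultimately show ?thesis unfolding UB by (intro LIMSEQ_le_const) auto
qed

locale shrinking_partitions =
  fixes c :: "nat \<Rightarrow> 'a::polish_space \<Rightarrow> nat list"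
  assumes code_measurable [measurable]: "\<And>n. c n \<in> measurable borel (count_space UNIV)"
    and length_code: "\<And>n x. length (c n x) = n"
    and code_refines: "\<And>m n x y. m \<le> n \<Longrightarrow> c n x = c n y \<Longrightarrow> c m x = c m y"
    and code_shrinks: "\<And>x A. open A \<Longrightarrow> x \<in> A \<Longrightarrow> \<forall>\<^sub>F n in sequentially. {y. c n y = c n x} \<subseteq> A"
begin

definition cell :: "nat \<Rightarrow> 'a \<Rightarrow> 'a set" where
  "cell n x = {y. c n y = c n x}"

lemma cell_self: "x \<in> cell n x"
  by (simp add: cell_def)

lemma cell_cong: "c n x = c n y \<Longrightarrow> cell n x = cell n y"
  by (simp add: cell_def)

lemma cell_eventually_subset: "open A \<Longrightarrow> x \<in> A \<Longrightarrow> \<forall>\<^sub>F n in sequentially. cell n x \<subseteq> A"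
  unfolding cell_def by (rule code_shrinks)

lemma code_level_set: "{x. c n x = l} \<in> sets borel"
proof -
  have "{x \<in> space borel. c n x = l} \<in> sets borel" by measurable
  then show ?thesis by simp
qed

lemma cell_borel [measurable]: "cell n x \<in> sets borel"
  unfolding cell_def by (rule code_level_set)

text \<open>A cell depends on its point only through the code, and every function on a discrete
  space is measurable; hence \<open>F\<close> needs no regularity.\<close>

lemma measurable_of_cell [measurable]: "(\<lambda>x. F (cell n x)) \<in> measurable borel (count_space UNIV)"
proof -
  have "(\<lambda>x. F {y. c n y = c n x}) = (\<lambda>l. F {y. c n y = l}) \<circ> c n" by auto
  moreover have "(\<lambda>l. F {y. c n y = l}) \<circ> c n \<in> measurable borel (count_space UNIV)"
    by (rule measurable_comp[OF code_measurable]) simp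
  ultimately show ?thesis by (simp add: cell_def)
qed

text \<open>For an open \<open>U\<close> around the exceptional set \<open>E\<close>, each point of \<open>E\<close> has a first cell inside \<open>U\<close> with
  average above \<open>b\<close>. These first cells are disjoint and their union \<open>G\<close> lies between \<open>E\<close> and \<open>U\<close>, while
  \<open>f < a\<close> on \<open>E\<close>: if \<open>U\<close> is close to \<open>E\<close> in measure, this leaves room only for a null set.\<close>

lemma limsup_cell_average_le:
  fixes f :: "'a \<Rightarrow> real"
  assumes M: "sets M = sets borel" "finite_measure M"
    and f: "integrable M f" and bound: "\<And>x. \<bar>f x\<bar> \<le> C" and ab: "a < b"
  shows "AE x in M. f x < a \<longrightarrow> (\<forall>\<^sub>F n in sequentially. (LINT y:cell n x|M. f y) \<le> b * measure M (cell n x))"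
proof -
  interpret finite_measure M by fact
  note [measurable_cong] = M(1)
  have space: "space M = UNIV" using sets_eq_imp_space_eq[OF M(1)] by simp
  have f_meas[measurable]: "f \<in> borel_measurable M" using f by auto
  have f_int: "set_integrable M A f" if "A \<in> sets borel" for A
    using that f M by (intro integrable_imp_set_integrable) auto
  have const_int: "set_integrable M A (\<lambda>_. r)" if "A \<in> sets borel" for A and r :: real
    using that M by (intro integrable_imp_set_integrable) auto
  have const_LINT: "(LINT y:A|M. r) = r * measure M A" if "A \<in> sets borel" for A and r :: real
    using that M(1) space by (simp add: set_lebesgue_integral_def)
  define big where "big n x \<longleftrightarrow> b * measure M (cell n x) < (LINT y:cell n x|M. f y)" for n x
  have [measurable]: "Measurable.pred borel (big n)" for n
    unfolding big_def using measurable_of_cell[of "\<lambda>B. b * measure M B < (LINT y:B|M. f y)" n] .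
  define E where "E = {x. f x < a \<and> (\<exists>\<^sub>F n in sequentially. big n x)}"
  have E[measurable]: "E \<in> sets borel"
  proof -
    have "E = {x \<in> space M. f x < a \<and> (\<forall>m. \<exists>n\<ge>m. big n x)}"
      by (auto simp: E_def space frequently_sequentially)
    also have "\<dots> \<in> sets M" by measurable
    finally show ?thesis using M by simp
  qed
  have C: "0 \<le> C" using bound[of undefined] by linarith
  \<comment> \<open>The integral of \<open>f - b\<close> over \<open>G\<close> is nonnegative, since
    each first cell has average above \<open>b\<close>; the integrand is at most
    \<open>a - b\<close> on \<open>E\<close> and at most \<open>C + \<bar>b\<bar>\<close>
    elsewhere.\<close>
  have key: "(b - a) * measure M E \<le> (C + \<bar>b\<bar>) * measure M (U - E)" if U: "open U" "E \<subseteq> U" for U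
  proof -
    define hit where "hit n x \<longleftrightarrow> cell n x \<subseteq> U \<and> big n x" for n x
    have hit_cong: "hit n x \<longleftrightarrow> hit n y" if "c n x = c n y" for n x y
      using cell_cong[OF that] by (simp add: hit_def big_def)
    have [measurable]: "Measurable.pred borel (hit n)" for n
      unfolding hit_def
      using measurable_of_cell[of "\<lambda>B. B \<subseteq> U" n] by measurable
    define G where "G = {x. \<exists>n. hit n x}"
    have G[measurable]: "G \<in> sets borel"
    proof -
      have "{x \<in> space borel. \<exists>n. hit n x} \<in> sets borel" by measurable
      then show ?thesis by (simp add: G_def)
    qed
    have "E \<subseteq> G"
    proof
      fix x assume x: "x \<in> E"
      then have "\<exists>\<^sub>F n in sequentially. big n x" by (simp add: E_def)
      moreover have "\<forall>\<^sub>F n in sequentially. cell n x \<subseteq> U"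
        using x U by (intro cell_eventually_subset) auto
      ultimately have "\<exists>\<^sub>F n in sequentially. cell n x \<subseteq> U \<and> big n x"
        by (rule frequently_eventually_conj)
      then show "x \<in> G"
        using frequently_ex unfolding G_def hit_def by blast
    qed
    have "G \<subseteq> U"
      using cell_self by (auto simp: G_def hit_def)
    \<comment> \<open>A stopping time: the first level at which the cell qualifies, while
      \<open>k x\<close> names that cell. Outside \<open>G\<close> the value is unspecified, but
      only \<open>G\<close> is integrated over.\<close>
    define T where "T x = (LEAST n. hit n x)" for x
    define k where "k x = c (T x) x" for x
    have [measurable]: "T \<in> measurable borel (count_space UNIV)"
      unfolding T_def by measurable
    have [measurable]: "k \<in> measurable borel (count_space UNIV)"
      unfolding k_def by (rule measurable_compose_countable) measurable
    have hit_T: "hit (T x) x" if "x \<in> G" for x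
      using that unfolding G_def T_def by (auto intro: LeastI)
    \<comment> \<open>Points sharing the cell at level \<open>T x\<close> share all coarser cells,
      so \<open>hit\<close> agrees for them at every level up to \<open>T x\<close>.\<close>
    have T_cong: "y \<in> G \<and> T y = T x" if "x \<in> G" "c (T x) y = c (T x) x" for x y
    proof -
      have eq: "hit n y \<longleftrightarrow> hit n x" if "n \<le> T x" for n
        using hit_cong code_refines[OF that \<open>c (T x) y = c (T x) x\<close>] by blast
      have "hit (T x) y" using eq hit_T[OF that(1)] by blast
      moreover have "\<not> hit n y" if "n < T x" for n
        using eq[of n] that not_less_Least[of n "\<lambda>n. hit n x"] by (auto simp: T_def)
      ultimately have "T y = T x"
        unfolding T_def[of y] by (metis Least_equality not_le)
      with \<open>hit (T x) y\<close> show ?thesis unfolding G_def by auto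
    qed
    have level: "{y \<in> G. k y = k x} = cell (T x) x" if x: "x \<in> G" for x
    proof (intro set_eqI iffI)
      fix y assume y: "y \<in> {y \<in> G. k y = k x}"
      \<comment> \<open>The length of a code is its level, so codes from different levels cannot
        coincide.\<close>
      then have "length (k y) = length (k x)" by simp
      then have "T y = T x" by (simp add: k_def length_code)
      with y show "y \<in> cell (T x) x" by (simp add: cell_def k_def)
    next
      fix y assume "y \<in> cell (T x) x"
      then have "c (T x) y = c (T x) x" by (simp add: cell_def)
      with T_cong[OF x this] show "y \<in> {y \<in> G. k y = k x}" by (simp add: k_def)
    qed
    have "0 \<le> (LINT x:G|M. f x - b)"
    proof (rule set_integral_countable_partition_nonneg[where k = k])
      show "set_integrable M G (\<lambda>x. f x - b)"
        by (intro set_integral_diff f_int const_int G)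
      fix i
      show "0 \<le> (LINT x:{x \<in> G. k x = i}|M. f x - b)"
      proof (cases "\<exists>x\<in>G. k x = i")
        case True
        then obtain x where x: "x \<in> G" "k x = i" by blast
        have "(LINT y:cell (T x) x|M. f y - b) = (LINT y:cell (T x) x|M. f y) - b * measure M (cell (T x) x)"
          by (subst set_integral_diff) (auto intro: f_int const_int simp: const_LINT)
        also have "\<dots> \<ge> 0" using hit_T[OF x(1)] by (simp add: hit_def big_def)
        finally show ?thesis using level[OF x(1)] x by simp
      next
        case False
        then have "{x \<in> G. k x = i} = {}" by blast
        then show ?thesis by (simp add: set_lebesgue_integral_def)
      qed
    qed auto
    also have "\<dots> = (LINT x:E|M. f x - b) + (LINT x:G - E|M. f x - b)"
    proof -
      have "G = E \<union> (G - E)" using \<open>E \<subseteq> G\<close> by blast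
      moreover have "(LINT x:E \<union> (G - E)|M. f x - b) = (LINT x:E|M. f x - b) + (LINT x:G - E|M. f x - b)"
        by (intro set_integral_Un set_integral_diff f_int const_int) auto
      ultimately show ?thesis by simp
    qed
    also have "\<dots> \<le> (LINT x:E|M. a - b) + (LINT x:G - E|M. C + \<bar>b\<bar>)"
    proof (intro add_mono set_integral_mono set_integral_diff f_int const_int)
      show "f x - b \<le> a - b" if "x \<in> E" for x using that by (simp add: E_def)
      show "f x - b \<le> C + \<bar>b\<bar>" for x using bound[of x] by linarith
    qed auto
    also have "\<dots> = (a - b) * measure M E + (C + \<bar>b\<bar>) * measure M (G - E)"
      by (simp add: const_LINT)
    also have "\<dots> \<le> (a - b) * measure M E + (C + \<bar>b\<bar>) * measure M (U - E)"
      using \<open>G \<subseteq> U\<close> C U M by (intro add_left_mono mult_left_mono finite_measure_mono) auto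
    finally show ?thesis by (simp add: algebra_simps)
  qed
  have "measure M E = 0"
  proof (rule ccontr)
    assume "measure M E \<noteq> 0"
    then have pos: "0 < (b - a) * measure M E" using ab by (simp add: zero_less_measure_iff)
    \<comment> \<open>If \<open>U - E\<close> has measure at most \<open>d\<close>, the right side
      of \<open>key\<close> is at most half of the left side; the \<open>+ 1\<close> keeps the
      divisor positive.\<close>
    define d where "d = (b - a) * measure M E / (2 * (C + \<bar>b\<bar> + 1))"
    have d: "d > 0" using pos C by (auto simp: d_def intro!: divide_pos_pos)
    have "emeasure M E = (INF U\<in>{U. E \<subseteq> U \<and> open U}. emeasure M U)"
      by (rule outer_regular) (use M E in auto)
    moreover have "emeasure M E < emeasure M E + ennreal d"
      using d by (simp add: emeasure_eq_measure ennreal_less_iff flip: ennreal_plus)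
    ultimately have "(INF U\<in>{U. E \<subseteq> U \<and> open U}. emeasure M U) < emeasure M E + ennreal d"
      by simp
    then obtain U where U: "E \<subseteq> U" "open U" "emeasure M U < emeasure M E + ennreal d"
      unfolding INF_less_iff by auto
    then have "measure M U < measure M E + d"
      using d by (simp add: emeasure_eq_measure ennreal_less_iff flip: ennreal_plus)
    then have "measure M (U - E) \<le> d"
      using U M E by (subst finite_measure_Diff) auto
    then have "(C + \<bar>b\<bar>) * measure M (U - E) \<le> (C + \<bar>b\<bar>) * d"
      using C by (intro mult_left_mono) auto
    also have "\<dots> < (b - a) * measure M E"
    proof -
      have "(C + \<bar>b\<bar>) * d \<le> (C + \<bar>b\<bar> + 1) * d" using d by (intro mult_right_mono) auto
      also have "\<dots> = (b - a) * measure M E / 2" using C by (simp add: d_def field_simps)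
      finally show ?thesis using pos by linarith
    qed
    finally show False using key[OF U(2,1)] by linarith
  qed
  then have "E \<in> null_sets M" using M E by (auto simp: emeasure_eq_measure)
  then have "AE x in M. x \<notin> E" by (rule AE_not_in)
  then show ?thesis
    by eventually_elim (auto simp: E_def big_def not_frequently not_less)
qed

text \<open>Each level has only countably many cells, so its null cells together form a null
  set.\<close>

lemma cell_measure_pos:
  assumes M: "sets M = sets borel" "finite_measure M"
  shows "AE x in M. \<forall>n. 0 < measure M (cell n x)"
proof -
  interpret finite_measure M by fact
  have "AE x in M. 0 < measure M (cell n x)" for n
  proof -
    define Z where "Z = {l. measure M {y. c n y = l} = 0}"
    have "(\<Union>l\<in>Z. {y. c n y = l}) \<in> null_sets M"
      using M code_level_set by (intro null_sets_UN') (auto simp: Z_def emeasure_eq_measure)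
    then have "AE x in M. x \<notin> (\<Union>l\<in>Z. {y. c n y = l})" by (rule AE_not_in)
    then show ?thesis
      by eventually_elim (auto simp: Z_def cell_def zero_less_measure_iff)
  qed
  then show ?thesis by (simp add: AE_all_countable)
qed

text \<open>The one-sided estimate is used for \<open>f\<close> and for \<open>- f\<close>.
  Restricting \<open>a < b\<close> to rational pairs leaves countably many exceptional null
  sets.\<close>

lemma cell_average_tendsto:
  fixes f :: "'a \<Rightarrow> real"
  assumes M: "sets M = sets borel" "finite_measure M"
    and f: "integrable M f" and bound: "\<And>x. \<bar>f x\<bar> \<le> C"
  shows "AE x in M. (\<lambda>n. (LINT y:cell n x|M. f y) / measure M (cell n x)) \<longlonglongrightarrow> f x"
proof -
  define Q where "Q = {(a, b). a \<in> \<rat> \<and> b \<in> \<rat> \<and> a < (b::real)}"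
  have Q: "countable Q"
    by (rule countable_subset[of _ "\<rat> \<times> \<rat>"]) (auto simp: Q_def countable_rat)
  have upper: "AE x in M. \<forall>p\<in>Q. g x < fst p \<longrightarrow>
      (\<forall>\<^sub>F n in sequentially. (LINT y:cell n x|M. g y) \<le> snd p * measure M (cell n x))"
    if "integrable M g" "\<And>x. \<bar>g x\<bar> \<le> C" for g :: "'a \<Rightarrow> real"
    unfolding AE_ball_countable[OF Q]
    using limsup_cell_average_le[OF M that] by (auto simp: Q_def)
  have ev: "\<forall>\<^sub>F n in sequentially. (LINT y:cell n x|M. g y) / measure M (cell n x) < r"
    if up: "\<forall>p\<in>Q. g x < fst p \<longrightarrow>
      (\<forall>\<^sub>F n in sequentially. (LINT y:cell n x|M. g y) \<le> snd p * measure M (cell n x))"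
      and pos: "\<forall>n. 0 < measure M (cell n x)" and r: "g x < r" for g :: "'a \<Rightarrow> real" and x r
  proof -
    obtain b where b: "b \<in> \<rat>" "g x < b" "b < r" using Rats_dense_in_real[OF r] by blast
    obtain a where a: "a \<in> \<rat>" "g x < a" "a < b" using Rats_dense_in_real[OF b(2)] by blast
    have "(a, b) \<in> Q" using a b by (simp add: Q_def)
    then have "\<forall>\<^sub>F n in sequentially. (LINT y:cell n x|M. g y) \<le> b * measure M (cell n x)"
      using up a by fastforce
    then show ?thesis
    proof eventually_elim
      case (elim n)
      then have "(LINT y:cell n x|M. g y) / measure M (cell n x) \<le> b"
        using pos by (simp add: divide_le_eq)
      then show ?case using b by simp
    qed
  qed
  have "AE x in M. \<forall>p\<in>Q. - f x < fst p \<longrightarrow>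
      (\<forall>\<^sub>F n in sequentially. (LINT y:cell n x|M. - f y) \<le> snd p * measure M (cell n x))"
    by (rule upper) (use f bound in auto)
  with upper[OF f bound] cell_measure_pos[OF M] show ?thesis
  proof eventually_elim
    case (elim x)
    show ?case
    proof (rule order_tendstoI)
      fix r assume "f x < r"
      then show "\<forall>\<^sub>F n in sequentially. (LINT y:cell n x|M. f y) / measure M (cell n x) < r"
        using elim by (intro ev)
    next
      fix r assume "r < f x"
      then have "\<forall>\<^sub>F n in sequentially. (LINT y:cell n x|M. - f y) / measure M (cell n x) < - r"
        using elim by (intro ev[where g="\<lambda>y. - f y"]) auto
      then show "\<forall>\<^sub>F n in sequentially. r < (LINT y:cell n x|M. f y) / measure M (cell n x)"
        by eventually_elim (simp add: set_lebesgue_integral_def)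
    qed
  qed
qed

end

section \<open>Vector measures\<close>

lemma vector_measure_sums:
  assumes "vector_measure N" "\<And>i::nat. A i \<in> sets borel" "disjoint_family A"
  shows "(\<lambda>i. N (A i)) sums N (\<Union>i. A i)"
  using assms unfolding vector_measure_def by blast

lemma vector_measure_Un:
  assumes N: "vector_measure N" and "A \<in> sets borel" "B \<in> sets borel" "A \<inter> B = {}"
  shows "N (A \<union> B) = N A + N B"
proof -
  have "(\<lambda>i. N (binaryset A B i)) sums N (\<Union>i. binaryset A B i)"
    by (rule vector_measure_sums[OF N])
      (use assms in \<open>auto simp: binaryset_def disjoint_family_on_def\<close>)
  moreover have "(\<lambda>i. N (binaryset A B i)) sums (N A + N B)"
    by (rule binaryset_sums, rule vector_measure_empty, rule N)
  ultimately show ?thesis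
    by (simp add: UN_binaryset_eq sums_unique2)
qed

lemma vector_measure_Diff:
  assumes N: "vector_measure N" and "A \<in> sets borel" "B \<in> sets borel" "B \<subseteq> A"
  shows "N (A - B) = N A - N B"
proof -
  have "N (B \<union> (A - B)) = N B + N (A - B)"
    using assms by (intro vector_measure_Un) auto
  moreover have "B \<union> (A - B) = A" using assms by auto
  ultimately show ?thesis by simp
qed

lemma vector_measure_finite_UN:
  assumes N: "vector_measure N" and "finite I" "\<And>i. i \<in> I \<Longrightarrow> A i \<in> sets borel"
    and "disjoint_family_on A I"
  shows "N (\<Union>i\<in>I. A i) = (\<Sum>i\<in>I. N (A i))"
  using assms(2-4)
proof (induction I)
  case (insert i I)
  have "N (A i \<union> (\<Union>i\<in>I. A i)) = N (A i) + N (\<Union>i\<in>I. A i)"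
  proof (rule vector_measure_Un[OF N])
    show "(\<Union>i\<in>I. A i) \<in> sets borel" using insert by (intro sets.finite_UN) auto
    show "A i \<inter> (\<Union>i\<in>I. A i) = {}"
      using insert unfolding disjoint_family_on_def by fastforce
  qed (use insert in auto)
  also have "N (\<Union>i\<in>I. A i) = (\<Sum>i\<in>I. N (A i))"
    using insert by (intro insert.IH) (auto simp: disjoint_family_on_def)
  finally show ?case using insert by simp
qed (simp add: vector_measure_empty[OF N])

lemma vector_measure_incseq:
  assumes N: "vector_measure N" and A: "\<And>i::nat. A i \<in> sets borel" "incseq A"
  shows "(\<lambda>i. N (A i)) \<longlonglongrightarrow> N (\<Union>i. A i)"
proof -
  have D: "disjointed A i \<in> sets borel" for i
    using sets.range_disjointed_sets[of A borel] A by auto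
  have "(\<lambda>i. N (disjointed A i)) sums N (\<Union>i. disjointed A i)"
    by (rule vector_measure_sums[OF N D disjoint_family_disjointed])
  moreover have "(\<Sum>i<Suc n. N (disjointed A i)) = N (A n)" for n
  proof (induction n)
    case (Suc n)
    have "N (disjointed A (Suc n)) = N (A (Suc n)) - N (A n)"
      using A by (simp add: disjointed_mono vector_measure_Diff[OF N] incseq_SucD)
    with Suc show ?case by simp
  qed simp
  ultimately show ?thesis
    unfolding sums_def UN_disjointed_eq using LIMSEQ_Suc by fastforce
qed

lemma vector_measure_bounded_linear:
  assumes "vector_measure N" "bounded_linear h"
  shows "vector_measure (\<lambda>B. h (N B))"
  using assms bounded_linear.sums unfolding vector_measure_def by blast

lemma norm_le_variation:
  assumes "B \<in> sets borel" "N {} = 0"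
  shows "ennreal (norm (N B)) \<le> variation N B"
proof (cases "B = {}")
  case False
  then have "(\<Sum>A\<in>{B}. ennreal (norm (N A))) \<le> variation N B"
    unfolding variation_def using assms
    by (intro SUP_upper) (auto simp: partition_on_def disjoint_def)
  then show ?thesis by simp
qed (use assms in simp)

text \<open>Gliding hump: an unbounded measure splits off disjoint pieces of norm at least \<open>n\<close>, one for
  each \<open>n\<close>, whose values cannot be summable.\<close>

lemma vector_measure_bounded:
  assumes N: "vector_measure N"
  obtains C where "\<And>B. B \<in> sets borel \<Longrightarrow> norm (N B) \<le> C"
proof (rule ccontr)
  assume "\<not> thesis"
  define bad where "bad E \<longleftrightarrow> E \<in> sets borel \<and> (\<forall>C. \<exists>B\<in>sets borel. B \<subseteq> E \<and> C < norm (N B))" for E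
  have "bad UNIV"
  proof -
    have "\<exists>B\<in>sets borel. B \<subseteq> UNIV \<and> C < norm (N B)" for C
    proof (rule ccontr)
      assume "\<not> (\<exists>B\<in>sets borel. B \<subseteq> UNIV \<and> C < norm (N B))"
      then have "norm (N B) \<le> C" if "B \<in> sets borel" for B
        using that by (meson not_le subset_UNIV)
      then have "thesis" by (rule that)
      with \<open>\<not> thesis\<close> show False ..
    qed
    then show ?thesis by (simp add: bad_def)
  qed
  have step: "\<exists>E'. bad E' \<and> E' \<subseteq> E \<and> real n < norm (N (E - E'))" if badE: "bad E" for E n
  proof -
    \<comment> \<open>The excess over \<open>norm (N E)\<close> makes both \<open>N B\<close> and
      \<open>N (E - B)\<close> large, so either half can be split off while a bad half is
      kept.\<close>
    obtain B where B: "B \<in> sets borel" "B \<subseteq> E" "norm (N E) + real n < norm (N B)"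
      using badE unfolding bad_def by blast
    have E: "E \<in> sets borel" using badE by (simp add: bad_def)
    have diff: "real n < norm (N (E - B))"
      using B E norm_triangle_ineq2[of "N B" "N E"]
      by (simp add: vector_measure_Diff[OF N] norm_minus_commute)
    \<comment> \<open>If neither half were bad, cutting each \<open>D\<close> into
      \<open>D \<inter> B\<close> and \<open>D - B\<close> would bound \<open>N\<close> on the
      subsets of \<open>E\<close>.\<close>
    have "bad B \<or> bad (E - B)"
    proof (rule ccontr)
      assume "\<not> (bad B \<or> bad (E - B))"
      moreover have "\<exists>C. \<forall>D\<in>sets borel. D \<subseteq> F \<longrightarrow> norm (N D) \<le> C"
        if "\<not> bad F" "F \<in> sets borel" for F
        using that unfolding bad_def by (meson not_le)
      ultimately obtain C1 C2 where C: "\<And>D. D \<in> sets borel \<Longrightarrow> D \<subseteq> B \<Longrightarrow> norm (N D) \<le> C1"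
        "\<And>D. D \<in> sets borel \<Longrightarrow> D \<subseteq> E - B \<Longrightarrow> norm (N D) \<le> C2"
        using B E sets.Diff[OF E B(1)] by meson
      obtain D where D: "D \<in> sets borel" "D \<subseteq> E" "C1 + C2 < norm (N D)"
        using badE unfolding bad_def by blast
      have "N (D \<inter> B \<union> (D - B)) = N (D \<inter> B) + N (D - B)"
        using B D by (intro vector_measure_Un[OF N]) auto
      moreover have "D \<inter> B \<union> (D - B) = D" by auto
      ultimately have "norm (N D) \<le> norm (N (D \<inter> B)) + norm (N (D - B))"
        by (simp add: norm_triangle_ineq)
      also have "\<dots> \<le> C1 + C2"
        using B D by (intro add_mono C) auto
      finally show False using D by simp
    qed
    then show ?thesis
    proof
      assume "bad B"
      then show ?thesis using diff B by blast
    next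
      assume "bad (E - B)"
      moreover have "real n < norm (N (E - (E - B)))"
      proof -
        have "E - (E - B) = B" using B by auto
        then show ?thesis using B(3) norm_ge_zero[of "N E"] by (simp del: norm_ge_zero)
      qed
      ultimately show ?thesis by blast
    qed
  qed
  obtain E where E: "E 0 = UNIV" "\<And>n. bad (E n)"
    and E_Suc: "\<And>n. E (Suc n) \<subseteq> E n \<and> real n < norm (N (E n - E (Suc n)))"
  proof -
    have "\<exists>E. \<forall>n. (bad (E n) \<and> (n = 0 \<longrightarrow> E n = UNIV)) \<and>
        (E (Suc n) \<subseteq> E n \<and> real n < norm (N (E n - E (Suc n))))"
      by (rule dependent_nat_choice) (use step \<open>bad UNIV\<close> in auto)
    then show ?thesis using that by blast
  qed
  have "decseq E" using E_Suc by (simp add: decseq_Suc_iff)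
  have "disjoint_family (\<lambda>n. E n - E (Suc n))"
  proof -
    have "(E m - E (Suc m)) \<inter> (E n - E (Suc n)) = {}" if "m < n" for m n
      using decseqD[OF \<open>decseq E\<close>, of "Suc m" n] that by auto
    then show ?thesis unfolding disjoint_family_on_def by (metis Int_commute nat_neq_iff)
  qed
  then have "(\<lambda>n. N (E n - E (Suc n))) sums N (\<Union>n. E n - E (Suc n))"
    using E by (intro vector_measure_sums[OF N]) (auto simp: bad_def)
  then have "(\<lambda>n. N (E n - E (Suc n))) \<longlonglongrightarrow> 0"
    using sums_summable summable_LIMSEQ_zero by blast
  then have "\<forall>\<^sub>F n in sequentially. norm (N (E n - E (Suc n))) < 1"
    by (auto dest: tendstoD[where e = 1])
  \<comment> \<open>Index \<open>0\<close> must be excluded: there the piece is only known to have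
    norm above \<open>0\<close>.\<close>
  moreover have "\<forall>\<^sub>F n in sequentially. 1 \<le> n" by (rule eventually_ge_at_top)
  ultimately have "\<forall>\<^sub>F n in sequentially. False"
  proof eventually_elim
    case (elim n)
    then show ?case using E_Suc[of n] by simp
  qed
  then show False by simp
qed

lemma finite_measure_total_variation:
  assumes "vector_measure N" "variation N UNIV < \<infinity>"
  shows "finite_measure (total_variation N)"
  using assms by (intro finite_measureI) (simp add: emeasure_total_variation)

text \<open>Group the pieces of a partition by the sign of \<open>N\<close>. Within a group the
  absolute values add up to the absolute value on the union, so a bound \<open>C\<close> for
  \<open>N\<close> gives \<open>2 * C\<close>.\<close>

lemma variation_real_finite:
  fixes N :: "'a::topological_space set \<Rightarrow> real"
  assumes N: "vector_measure N"
  shows "variation N UNIV < \<infinity>"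
proof -
  obtain C where C: "\<And>B. B \<in> sets borel \<Longrightarrow> norm (N B) \<le> C"
    using vector_measure_bounded[OF N] by blast
  have "variation N UNIV \<le> ennreal (2 * C)"
    unfolding variation_def
  proof (rule SUP_least)
    fix P :: "'a set set" assume P: "P \<in> {P. finite P \<and> P \<subseteq> sets borel \<and> partition_on UNIV P}"
    let ?P = "{A \<in> P. 0 \<le> N A}" and ?Q = "{A \<in> P. N A < 0}"
    have disj: "disjoint_family_on (\<lambda>A. A) P"
      using P by (simp add: partition_on_def disjoint_def disjoint_family_on_def)
    have UN: "N (\<Union>A\<in>S. A) = (\<Sum>A\<in>S. N A)" if "S \<subseteq> P" for S
      using P that finite_subset[OF that] disjoint_family_on_mono[OF that disj]
      by (intro vector_measure_finite_UN[OF N]) auto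
    have meas: "(\<Union>A\<in>S. A) \<in> sets borel" if "S \<subseteq> P" for S
      using P that finite_subset[OF that] by (intro sets.finite_UN) auto
    have "(\<Sum>A\<in>P. norm (N A)) = (\<Sum>A\<in>?P. norm (N A)) + (\<Sum>A\<in>?Q. norm (N A))"
      using P by (subst sum.union_disjoint[symmetric]) (auto intro!: sum.cong)
    also have "\<dots> = N (\<Union>A\<in>?P. A) - N (\<Union>A\<in>?Q. A)"
      by (simp only: UN[OF Collect_restrict]) (simp add: sum_negf[symmetric])
    also have "\<dots> \<le> 2 * C"
      using C[OF meas[OF Collect_restrict], of "\<lambda>A. 0 \<le> N A"]
        C[OF meas[OF Collect_restrict], of "\<lambda>A. N A < 0"] by auto
    finally show "(\<Sum>A\<in>P. ennreal (norm (N A))) \<le> ennreal (2 * C)"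
      by (simp add: ennreal_leI)
  qed
  then show ?thesis by (simp add: order_le_less_trans)
qed

text \<open>The error is the value of \<open>N\<close> on \<open>B - K\<close>, controlled by the
  variation of that set; the variation is a finite measure on a Polish space, hence inner
  regular.\<close>

lemma real_vector_measure_inner_approx:
  fixes N :: "'a::polish_space set \<Rightarrow> real"
  assumes N: "vector_measure N" and B: "B \<in> sets borel" and "0 < e"
  obtains K where "closed K" "K \<subseteq> B" "\<bar>N B - N K\<bar> < e"
proof -
  let ?M = "total_variation N"
  interpret finite_measure ?M
    by (rule finite_measure_total_variation[OF N variation_real_finite[OF N]])
  show thesis
  \<comment> \<open>Null sets are separated because \<open>ennreal\<close> truncates the negative
    number \<open>measure ?M B - e\<close> to \<open>0\<close>, which leaves no strict gap below a
    zero measure.\<close>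
  proof (cases "measure ?M B = 0")
    case True
    then have "variation N B = 0"
      using emeasure_total_variation[OF N B] by (simp add: emeasure_eq_measure)
    then have "N B = 0"
      using norm_le_variation[of B N] B vector_measure_empty[OF N] by simp
    then show ?thesis using that[of "{}"] \<open>0 < e\<close> by (simp add: vector_measure_empty[OF N])
  next
    case False
    then have "measure ?M B > 0" by (simp add: zero_less_measure_iff)
    then have "ennreal (measure ?M B - e) < emeasure ?M B"
      using \<open>0 < e\<close> by (simp add: emeasure_eq_measure ennreal_lessI)
    also have "emeasure ?M B = (SUP K\<in>{K. K \<subseteq> B \<and> compact K}. emeasure ?M K)"
      by (rule inner_regular) (use B in auto)
    finally obtain K where K: "K \<subseteq> B" "compact K" "ennreal (measure ?M B - e) < emeasure ?M K"
      unfolding less_SUP_iff by auto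
    then have "closed K" by (simp add: compact_imp_closed)
    then have Kb: "K \<in> sets borel" by simp
    have "measure ?M B - e < measure ?M K"
      using K by (simp add: emeasure_eq_measure ennreal_less_iff
          split: if_splits) (meson ennreal_leI linorder_not_le)
    then have "measure ?M (B - K) < e"
      using K Kb B by (subst finite_measure_Diff) auto
    moreover have "ennreal \<bar>N B - N K\<bar> \<le> ennreal (measure ?M (B - K))"
      using norm_le_variation[of "B - K" N] vector_measure_empty[OF N] emeasure_total_variation[OF N, of "B - K"] B Kb K
      by (simp add: vector_measure_Diff[OF N] emeasure_eq_measure)
    ultimately have "\<bar>N B - N K\<bar> < e" by simp
    with \<open>closed K\<close> K that show ?thesis by blast
  qed
qed

section \<open>Cutoffs and finiteness of the variation\<close>

lemma apply_bcontfun_mult [simp]: "bcontfun_mult f g x = f x * g x"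
  by transfer simp

lemma apply_bcontfun_max [simp]: "bcontfun_max f g x = max (f x) (g x)"
  by transfer simp

lemma apply_bcontfun_min [simp]: "bcontfun_min f g x = min (f x) (g x)"
  by transfer simp

lemma bcontfun_supp_zero [simp]: "bcontfun_supp 0 = {}"
  by (simp add: bcontfun_supp_def)

lemma bcontfun_zero_outside_supp: "x \<notin> bcontfun_supp f \<Longrightarrow> f x = 0"
  using closure_subset[of "{x. f x \<noteq> 0}"] by (auto simp: bcontfun_supp_def)

text \<open>The unit ball is symmetric, so an upper bound without absolute values is enough to
  control the norm.\<close>

lemma norm_le_of_unit_ball_bound:
  fixes f :: "'v::real_normed_vector \<Rightarrow>\<^sub>L real"
  assumes bound: "\<And>v. norm v \<le> 1 \<Longrightarrow> f v \<le> c"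
  shows "norm f \<le> c"
proof (rule norm_blinfun_bound)
  show "0 \<le> c" using bound[of 0] by simp
  fix v
  show "norm (f v) \<le> c * norm v"
  proof (cases "v = 0")
    case False
    have "\<bar>f v / norm v\<bar> \<le> c"
      using bound[of "v /\<^sub>R norm v"] bound[of "- (v /\<^sub>R norm v)"] False
      by (auto simp: blinfun.bilinear_simps abs_if divide_inverse mult.commute)
    then show ?thesis using False by (simp add: field_simps)
  qed simp
qed

section \<open>Seminorms and cutoffs in a normed module\<close>

locale normed_module_action =
  fixes R :: "('a::topological_space \<Rightarrow>\<^sub>C real) set"
    and act :: "('a \<Rightarrow>\<^sub>C real) \<Rightarrow> 'v::real_normed_vector \<Rightarrow> 'v"
  assumes module: "normed_module R act"
begin

lemma approximates: "approximates_open_sets R"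
  using module by (simp add: normed_module_def)

lemma const_one_mem: "const_bcontfun 1 \<in> R"
  using approximates by (simp add: approximates_open_sets_def bcontfun_subring_def)

lemma add_mem: "f \<in> R \<Longrightarrow> g \<in> R \<Longrightarrow> f + g \<in> R"
  and minus_mem: "f \<in> R \<Longrightarrow> - f \<in> R"
  and max_mem: "f \<in> R \<Longrightarrow> g \<in> R \<Longrightarrow> bcontfun_max f g \<in> R"
  and min_mem: "f \<in> R \<Longrightarrow> g \<in> R \<Longrightarrow> bcontfun_min f g \<in> R"
  and scale_mem: "f \<in> R \<Longrightarrow> r *\<^sub>R f \<in> R"
  using approximates by (auto simp: approximates_open_sets_def bcontfun_subring_def)

lemma zero_mem: "0 \<in> R"
  using add_mem[OF const_one_mem minus_mem[OF const_one_mem]] by simp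

lemma act_add_right: "f \<in> R \<Longrightarrow> act f (v + w) = act f v + act f w"
  and act_add_left: "f \<in> R \<Longrightarrow> g \<in> R \<Longrightarrow> act (f + g) v = act f v + act g v"
  and act_mult: "f \<in> R \<Longrightarrow> g \<in> R \<Longrightarrow> act (bcontfun_mult f g) v = act f (act g v)"
  using module by (auto simp: normed_module_def)

lemma act_zero_left [simp]: "act 0 v = 0"
  using act_add_left[OF zero_mem zero_mem, of v] by simp

lemma act_diff_right: "f \<in> R \<Longrightarrow> act f (v - w) = act f v - act f w"
  using act_add_right[of f "v - w" w] by (simp add: algebra_simps)

text \<open>Free bounds \<open>a\<close> and \<open>b\<close> in place of the maxima make the module
  axiom easier to apply and admit the empty sum.\<close>

lemma norm_sum_act_le:
  fixes n :: nat
  assumes "\<And>i. i < n \<Longrightarrow> f i \<in> R" and "disjoint_family_on (\<lambda>i. bcontfun_supp (f i)) {..<n}"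
    and f: "\<And>i. i < n \<Longrightarrow> norm (f i) \<le> a" and v: "\<And>i. i < n \<Longrightarrow> norm (v i) \<le> b"
    and nonneg: "0 \<le> a" "0 \<le> b"
  shows "norm (\<Sum>i<n. act (f i) (v i)) \<le> a * b"
proof (cases "n = 0")
  case False
  then have ne: "{..<n} \<noteq> {}" by auto
  have "norm (\<Sum>i<n. act (f i) (v i)) \<le> (MAX i\<in>{..<n}. norm (f i)) * (MAX i\<in>{..<n}. norm (v i))"
    using module assms False unfolding normed_module_def by auto
  also have "\<dots> \<le> a * b"
  proof (rule mult_mono)
    have "0 \<le> norm (v 0)" by simp
    also have "\<dots> \<le> (MAX i\<in>{..<n}. norm (v i))" using False by (intro Max_ge) auto
    finally show "0 \<le> (MAX i\<in>{..<n}. norm (v i))" .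
  qed (use ne f v nonneg in \<open>auto simp: Max_le_iff\<close>)
  finally show ?thesis .
qed (use nonneg in simp)

lemma norm_act_le: "f \<in> R \<Longrightarrow> norm (act f v) \<le> norm f * norm v"
  using norm_sum_act_le[of 1 "\<lambda>_. f" "norm f" "\<lambda>_. v" "norm v"]
  by (simp add: disjoint_family_on_def)

lemma local_seminorm_bdd_above:
  "bdd_above ((\<lambda>f. norm (act f v)) ` {f \<in> R. bcontfun_supp f \<subseteq> A \<and> norm f \<le> 1})"
proof (rule bdd_aboveI2)
  fix f assume "f \<in> {f \<in> R. bcontfun_supp f \<subseteq> A \<and> norm f \<le> 1}"
  then show "norm (act f v) \<le> norm v"
    using norm_act_le[of f v] mult_right_mono[of "norm f" 1 "norm v"] by simp
qed

lemma norm_act_le_local_seminorm: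
  "f \<in> R \<Longrightarrow> bcontfun_supp f \<subseteq> A \<Longrightarrow> norm f \<le> 1 \<Longrightarrow> norm (act f v) \<le> local_seminorm R act A v"
  unfolding local_seminorm_def by (rule cSUP_upper[OF _ local_seminorm_bdd_above]) simp

lemma local_seminorm_nonneg: "0 \<le> local_seminorm R act A v"
  using norm_act_le_local_seminorm[of 0 A v] zero_mem by simp

lemma local_seminorm_le_norm: "local_seminorm R act A v \<le> norm v"
  unfolding local_seminorm_def
proof (rule cSUP_least)
  show "{f \<in> R. bcontfun_supp f \<subseteq> A \<and> norm f \<le> 1} \<noteq> {}"
    using zero_mem by (auto intro!: exI[of _ 0])
  fix f assume "f \<in> {f \<in> R. bcontfun_supp f \<subseteq> A \<and> norm f \<le> 1}"
  then show "norm (act f v) \<le> norm v"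
    using norm_act_le[of f v] mult_right_mono[of "norm f" 1 "norm v"] by simp
qed

lemma local_seminorm_eq_0:
  assumes "\<And>h. h \<in> R \<Longrightarrow> bcontfun_supp h \<subseteq> A \<Longrightarrow> act h v = 0"
  shows "local_seminorm R act A v = 0"
proof (rule antisym[OF _ local_seminorm_nonneg])
  show "local_seminorm R act A v \<le> 0"
    unfolding local_seminorm_def using zero_mem assms
    by (intro cSUP_least) (auto intro!: exI[of _ 0])
qed

lemma germ_seminorm_le_norm: "germ_seminorm R act v x \<le> norm v"
proof -
  have "germ_seminorm R act v x \<le> local_seminorm R act UNIV v"
    unfolding germ_seminorm_def
    by (rule cINF_lower) (auto intro!: bdd_belowI2[of _ 0] local_seminorm_nonneg)
  then show ?thesis using local_seminorm_le_norm order_trans by blast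
qed

text \<open>Composing an approximation \<open>F k\<close> of the indicator of \<open>A\<close> with a piecewise linear function that
  vanishes below \<open>1/3\<close> and equals \<open>1\<close> above \<open>2/3\<close> produces cutoffs supported inside \<open>A\<close>.\<close>

lemma cutoffs_exist:
  assumes "open A"
  obtains g :: "nat \<Rightarrow> 'a \<Rightarrow>\<^sub>C real" and W :: "nat \<Rightarrow> 'a set"
  where "\<And>k. g k \<in> R" "\<And>k. bcontfun_supp (g k) \<subseteq> A" "\<And>k. norm (g k) \<le> 1"
    "\<And>k. open (W k)" "\<And>k x. x \<in> W k \<Longrightarrow> g k x = 1" "incseq W" "(\<Union>k. W k) = A"
proof -
  obtain F :: "nat \<Rightarrow> 'a \<Rightarrow>\<^sub>C real" where F: "\<And>k. F k \<in> R" "\<And>x. incseq (\<lambda>k. F k x)"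
    "\<And>x. (\<lambda>k. F k x) \<longlonglongrightarrow> indicator A x"
  proof -
    have "\<exists>F :: nat \<Rightarrow> 'a \<Rightarrow>\<^sub>C real. range F \<subseteq> R \<and>
        (\<forall>x. incseq (\<lambda>k. F k x) \<and> (\<lambda>k. F k x) \<longlonglongrightarrow> indicator A x)"
      using approximates assms by (simp add: approximates_open_sets_def)
    then obtain F :: "nat \<Rightarrow> 'a \<Rightarrow>\<^sub>C real" where "range F \<subseteq> R"
        "\<forall>x. incseq (\<lambda>k. F k x) \<and> (\<lambda>k. F k x) \<longlonglongrightarrow> indicator A x"
      by (elim exE conjE)
    then show thesis by (intro that[of F]) auto
  qed
  have F_le: "F k x \<le> indicator A x" for k x
    using incseq_le[OF F(2,3)] .
  define g where "g k = bcontfun_max 0 (bcontfun_min (const_bcontfun 1) (3 *\<^sub>R F k + - const_bcontfun 1))" for k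
  have g: "g k x = max 0 (min 1 (3 * F k x - 1))" for k x
    by (simp add: g_def const_bcontfun.rep_eq)
  define W where "W k = {x. 2 / 3 < F k x}" for k
  show thesis
  proof (rule that)
    show "g k \<in> R" for k
      unfolding g_def
      by (intro max_mem min_mem add_mem minus_mem scale_mem zero_mem const_one_mem F)
    show "bcontfun_supp (g k) \<subseteq> A" for k
    proof -
      \<comment> \<open>The support is a closure, so a closed set has to be fitted between it and
        \<open>A\<close>; off \<open>A\<close> the values \<open>F k x\<close> are at most
        \<open>0\<close>, below the threshold.\<close>
      have "closure {x. g k x \<noteq> 0} \<subseteq> {x. 1 / 3 \<le> F k x}"
        by (intro closure_minimal closed_Collect_le continuous_intros) (auto simp: g)
      also have "\<dots> \<subseteq> A"
      proof
        fix x assume "x \<in> {x. 1 / 3 \<le> F k x}"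
        then show "x \<in> A" using F_le[of k x] by (cases "x \<in> A") auto
      qed
      finally show ?thesis by (simp add: bcontfun_supp_def)
    qed
    show "norm (g k) \<le> 1" for k by (rule norm_bound) (simp add: g)
    show "open (W k)" for k
      unfolding W_def by (intro open_Collect_less continuous_intros) auto
    show "g k x = 1" if "x \<in> W k" for k x using that by (simp add: g W_def)
    show "incseq W"
    proof (intro incseq_SucI subsetI)
      fix k x assume "x \<in> W k"
      then show "x \<in> W (Suc k)" using incseq_SucD[OF F(2), of k x] by (simp add: W_def)
    qed
    show "(\<Union>k. W k) = A"
    proof (intro equalityI subsetI)
      fix x assume "x \<in> (\<Union>k. W k)"
      then obtain k where "2 / 3 < F k x" by (auto simp: W_def)
      then show "x \<in> A" using F_le[of k x] by (cases "x \<in> A") auto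
    next
      fix x assume "x \<in> A"
      then have "\<forall>\<^sub>F k in sequentially. 2 / 3 < F k x"
        using F(3)[of x] by (intro order_tendstoD(1)[where y = 1]) auto
      then show "x \<in> (\<Union>k. W k)"
        using eventually_happens by (fastforce simp: W_def)
    qed
  qed
qed

end

section \<open>Localization and finiteness for local vector measures\<close>

locale local_measure = normed_module_action R act
  for R :: "('a::polish_space \<Rightarrow>\<^sub>C real) set"
    and act :: "('a \<Rightarrow>\<^sub>C real) \<Rightarrow> 'v::real_normed_vector \<Rightarrow> 'v" +
  fixes N :: "'a set \<Rightarrow> 'v \<Rightarrow>\<^sub>L real"
  assumes locality: "local_vector_measure R act N"
begin

lemma vector_measure: "vector_measure N"
  using locality by (simp add: local_vector_measure_def)

lemma vector_measure_at: "vector_measure (\<lambda>B. N B v)"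
  by (rule vector_measure_bounded_linear[OF vector_measure blinfun.bounded_linear_left])

text \<open>Locality gives vanishing on open subsets of \<open>W\<close>. Open sets are stable under
  intersection and generate the Borel sets, so a Dynkin argument for the sets
  \<open>D \<inter> W\<close> extends this to all Borel \<open>D\<close>.\<close>

lemma measure_vanishes_on:
  assumes W: "open W" and w: "\<And>h. h \<in> R \<Longrightarrow> bcontfun_supp h \<subseteq> W \<Longrightarrow> act h w = 0"
    and B: "B \<in> sets borel" "B \<subseteq> W"
  shows "N B w = 0"
proof -
  note vm = vector_measure_at[of w]
  have open_0: "N A w = 0" if "open A" "A \<subseteq> W" for A
    using locality that w local_seminorm_eq_0[of A w] unfolding local_vector_measure_def by blast
  have "N (D \<inter> W) w = 0" if "D \<in> sigma_sets UNIV {A. open A}" for D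
  proof -
    have "Int_stable {A :: 'a set. open A}" "{A. open A} \<subseteq> Pow (UNIV :: 'a set)"
      by (auto simp: Int_stable_def)
    then show ?thesis using that
    proof (induction rule: sigma_sets_induct_disjoint)
      case (basic A)
      then show ?case using W by (intro open_0) auto
    next
      case empty
      then show ?case using open_0[of "{}"] by simp
    next
      case (compl A)
      then have "A \<in> sets borel" by (simp add: borel_def)
      moreover have "(UNIV - A) \<inter> W = W - A \<inter> W" by auto
      ultimately show ?case
        using compl W open_0[OF W] by (simp add: vector_measure_Diff[OF vm])
    next
      case (union A)
      then have A: "A i \<in> sets borel" for i by (auto simp: borel_def)
      have "(\<lambda>i. N (A i \<inter> W) w) sums N (\<Union>i. A i \<inter> W) w"
        by (rule vector_measure_sums[OF vm])
          (use A W union in \<open>auto simp: disjoint_family_on_def\<close>)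
      then show ?case using union sums_unique2[OF sums_zero] by fastforce
    qed
  qed
  from this[of B] show ?thesis using B by (simp add: borel_def Int_absorb2)
qed

text \<open>For \<open>h\<close> supported in \<open>W\<close> the product of \<open>h\<close> and
  \<open>g\<close> is \<open>h\<close>, so \<open>h\<close> annihilates \<open>act g v - v\<close>,
  and locality removes the difference on \<open>W\<close>.\<close>

lemma measure_act_cutoff:
  assumes W: "open W" and g: "g \<in> R" "\<And>x. x \<in> W \<Longrightarrow> g x = 1"
    and B: "B \<in> sets borel" "B \<subseteq> W"
  shows "N B (act g v) = N B v"
proof -
  have "N B (act g v - v) = 0"
  proof (rule measure_vanishes_on[OF W _ B])
    fix h assume h: "h \<in> R" "bcontfun_supp h \<subseteq> W"
    have "bcontfun_mult h g = h"
    proof (rule bcontfun_eqI)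
      fix x
      have "h x = 0" if "x \<notin> W"
        using that h by (intro bcontfun_zero_outside_supp) auto
      then show "bcontfun_mult h g x = h x" using g by (cases "x \<in> W") auto
    qed
    then show "act h (act g v - v) = 0"
      using h g by (simp add: act_diff_right flip: act_mult)
  qed
  then show ?thesis by (simp add: blinfun.bilinear_simps)
qed

lemma measure_act_disjoint:
  assumes W: "open W" and g: "g \<in> R" "\<And>x. x \<in> W \<Longrightarrow> g x = 0"
    and B: "B \<in> sets borel" "B \<subseteq> W"
  shows "N B (act g v) = 0"
proof (rule measure_vanishes_on[OF W _ B])
  fix h assume h: "h \<in> R" "bcontfun_supp h \<subseteq> W"
  have "bcontfun_mult h g = 0"
  proof (rule bcontfun_eqI)
    fix x
    have "h x = 0" if "x \<notin> W"
      using that h by (intro bcontfun_zero_outside_supp) auto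
    then show "bcontfun_mult h g x = (0 :: 'a \<Rightarrow>\<^sub>C real) x" using g by (cases "x \<in> W") auto
  qed
  then show "act h (act g v) = 0"
    using h g by (simp flip: act_mult)
qed

text \<open>The sets on which the cutoffs equal \<open>1\<close> increase to \<open>U\<close>, which
  contains \<open>K\<close>; continuity from below along \<open>K \<inter> W k\<close> singles out
  one \<open>k\<close>.\<close>

lemma cutoff_approx:
  assumes K: "closed K" and U: "open U" "K \<subseteq> U" and "0 < e"
  obtains g W where "g \<in> R" "bcontfun_supp g \<subseteq> U" "norm g \<le> 1" "open W" "W \<subseteq> U"
    "\<forall>x\<in>W. g x = 1" "\<bar>N K v - N (K \<inter> W) v\<bar> < e"
proof -
  obtain g W where gW: "\<And>k. g k \<in> R" "\<And>k. bcontfun_supp (g k) \<subseteq> U" "\<And>k. norm (g k) \<le> 1"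
    "\<And>k. open (W k)" "\<And>k x. x \<in> W k \<Longrightarrow> g k x = 1" "incseq W" "(\<Union>k. W k) = U"
    using cutoffs_exist[OF U(1)] by metis
  have "(\<lambda>k. N (K \<inter> W k) v) \<longlonglongrightarrow> N (\<Union>k. K \<inter> W k) v"
    by (rule vector_measure_incseq[OF vector_measure_at])
      (use K gW(4,6) in \<open>auto simp: incseq_Suc_iff\<close>)
  moreover have "(\<Union>k. K \<inter> W k) = K" using gW(7) U by (simp add: Int_absorb2)
  ultimately have "(\<lambda>k. N (K \<inter> W k) v) \<longlonglongrightarrow> N K v" by simp
  then have "\<forall>\<^sub>F k in sequentially. dist (N (K \<inter> W k) v) (N K v) < e"
    by (rule tendstoD) fact
  then obtain k where k: "dist (N (K \<inter> W k) v) (N K v) < e"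
    using eventually_happens'[OF sequentially_bot] by blast
  show thesis
  proof (rule that[OF gW(1-4)])
    show "W k \<subseteq> U" using gW(7) by blast
    show "\<forall>x\<in>W k. g k x = 1" using gW(5) by blast
    show "\<bar>N K v - N (K \<inter> W k) v\<bar> < e"
      using k by (simp add: dist_real_def abs_minus_commute)
  qed
qed

text \<open>The error \<open>e\<close> is spent in thirds: on a near-norming vector
  \<open>v i\<close>, on a closed \<open>K i\<close> inside \<open>A i\<close>, and on the part
  \<open>B i\<close> of \<open>K i\<close> where the cutoff is known to equal \<open>1\<close>. On
  \<open>B i\<close> only summand \<open>i\<close> of \<open>w\<close> is seen, so the sum of norms
  is nearly a single value of \<open>N\<close> at a vector of the unit ball.\<close>

lemma sum_norm_disjoint_le:
  fixes A :: "nat \<Rightarrow> 'a set"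
  assumes A: "\<And>i. i < n \<Longrightarrow> A i \<in> sets borel" "disjoint_family_on A {..<n}"
    and C: "\<And>B. B \<in> sets borel \<Longrightarrow> norm (N B) \<le> C" and "0 < e"
  shows "(\<Sum>i<n. norm (N (A i)) - e) \<le> C"
proof -
  have "\<exists>v. norm v \<le> 1 \<and> norm (N (A i)) - e / 3 < N (A i) v" for i
  proof (rule ccontr)
    assume "\<not> ?thesis"
    then have "norm (N (A i)) \<le> norm (N (A i)) - e / 3"
      by (intro norm_le_of_unit_ball_bound) (auto simp: not_less)
    then show False using \<open>0 < e\<close> by simp
  qed
  then obtain v where v: "\<And>i. norm (v i) \<le> 1" "\<And>i. norm (N (A i)) - e / 3 < N (A i) (v i)"
    by metis
  have "\<exists>K. i < n \<longrightarrow> closed K \<and> K \<subseteq> A i \<and> \<bar>N (A i) (v i) - N K (v i)\<bar> < e / 3" for i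
    using real_vector_measure_inner_approx[OF vector_measure_at[of "v i"], of "A i" "e / 3"] A \<open>0 < e\<close>
    by (metis divide_pos_pos zero_less_numeral)
  then obtain K where K: "\<And>i. i < n \<Longrightarrow> closed (K i)" "\<And>i. i < n \<Longrightarrow> K i \<subseteq> A i"
    "\<And>i. i < n \<Longrightarrow> \<bar>N (A i) (v i) - N (K i) (v i)\<bar> < e / 3"
    by metis
  have K_disj: "K i \<inter> K j = {}" if "i < n" "j < n" "i \<noteq> j" for i j
    using A(2) K(2) that unfolding disjoint_family_on_def by blast
  have "\<exists>S T. i < n \<and> j < n \<and> i \<noteq> j \<longrightarrow> open S \<and> open T \<and> K i \<subseteq> S \<and> K j \<subseteq> T \<and> S \<inter> T = {}" for i j
    using t4_space[of "K i" "K j"] K(1) K_disj by meson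
  then obtain S T where ST: "\<And>i j. i < n \<Longrightarrow> j < n \<Longrightarrow> i \<noteq> j \<Longrightarrow>
      open (S i j) \<and> open (T i j) \<and> K i \<subseteq> S i j \<and> K j \<subseteq> T i j \<and> S i j \<inter> T i j = {}"
    by metis
  \<comment> \<open>\<open>S\<close> and \<open>T\<close> separate ordered pairs; intersecting over
    both roles of the index \<open>i\<close> gives one neighbourhood of \<open>K i\<close> disjoint
    from all the other \<open>U j\<close>.\<close>
  define U where "U i = (\<Inter>j\<in>{..<n} - {i}. S i j \<inter> T j i)" for i
  have U_open: "open (U i)" and K_U: "K i \<subseteq> U i" if "i < n" for i
  proof -
    have "open (S i j \<inter> T j i) \<and> K i \<subseteq> S i j \<inter> T j i" if "j \<in> {..<n} - {i}" for j
      using ST[of i j] ST[of j i] that \<open>i < n\<close> by (auto intro: open_Int)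
    then show "open (U i)" "K i \<subseteq> U i"
      unfolding U_def by (auto intro!: open_INT simp del: INT_simps)
  qed
  have U_disj: "U i \<inter> U j = {}" if "i < n" "j < n" "i \<noteq> j" for i j
  proof -
    have "U i \<subseteq> S i j" "U j \<subseteq> T i j"
      using that unfolding U_def by auto
    then show ?thesis using ST[OF that] by blast
  qed
  define good where "good i g W \<longleftrightarrow> g \<in> R \<and> bcontfun_supp g \<subseteq> U i \<and> norm g \<le> 1 \<and> open W \<and> W \<subseteq> U i \<and>
      (\<forall>x\<in>W. g x = 1) \<and> \<bar>N (K i) (v i) - N (K i \<inter> W) (v i)\<bar> < e / 3" for i g W
  have "\<exists>g W. i < n \<longrightarrow> good i g W" for i
    using cutoff_approx[OF K(1) U_open K_U, of i "e / 3" "v i"] \<open>0 < e\<close>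
    unfolding good_def by (metis divide_pos_pos zero_less_numeral)
  then obtain g W where "\<And>i. i < n \<Longrightarrow> good i (g i) (W i)" by metis
  then have g: "\<And>i. i < n \<Longrightarrow> g i \<in> R" "\<And>i. i < n \<Longrightarrow> bcontfun_supp (g i) \<subseteq> U i"
      "\<And>i. i < n \<Longrightarrow> norm (g i) \<le> 1"
    and W: "\<And>i. i < n \<Longrightarrow> open (W i)" "\<And>i. i < n \<Longrightarrow> W i \<subseteq> U i" "\<And>i x. i < n \<Longrightarrow> x \<in> W i \<Longrightarrow> g i x = 1"
    and KW: "\<And>i. i < n \<Longrightarrow> \<bar>N (K i) (v i) - N (K i \<inter> W i) (v i)\<bar> < e / 3"
    by (simp_all add: good_def)
  define w where "w = (\<Sum>i<n. act (g i) (v i))"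
  define B where "B i = K i \<inter> W i" for i
  have B: "B i \<in> sets borel" if "i < n" for i
    using K(1) W(1) that by (auto simp: B_def)
  have "norm w \<le> 1 * 1"
    unfolding w_def
  proof (rule norm_sum_act_le)
    show "disjoint_family_on (\<lambda>i. bcontfun_supp (g i)) {..<n}"
      using g(2) U_disj unfolding disjoint_family_on_def by blast
  qed (use g v in auto)
  have Bw: "N (B i) w = N (B i) (v i)" if i: "i < n" for i
  proof -
    have "N (B i) (act (g j) (v j)) = (if j = i then N (B i) (v i) else 0)" if j: "j < n" for j
    proof (cases "j = i")
      case True
      then show ?thesis
        using measure_act_cutoff[OF W(1)[OF i] g(1)[OF i] W(3)[OF i] B[OF i]] by (simp add: B_def)
    next
      case False
      have "g j x = 0" if "x \<in> W i" for x
      proof -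
        have "x \<notin> bcontfun_supp (g j)"
          using that W(2)[OF i] g(2)[OF j] U_disj[OF i j] False by blast
        then show ?thesis by (rule bcontfun_zero_outside_supp)
      qed
      then show ?thesis
        using measure_act_disjoint[OF W(1)[OF i] g(1)[OF j] _ B[OF i]] False by (simp add: B_def)
    qed
    then have "N (B i) w = (\<Sum>j<n. if j = i then N (B i) (v i) else 0)"
      unfolding w_def by (simp add: blinfun.sum_right)
    then show ?thesis using i by simp
  qed
  have "(\<Sum>i<n. norm (N (A i)) - e) \<le> (\<Sum>i<n. N (B i) w)"
  proof (rule sum_mono)
    fix i assume "i \<in> {..<n}"
    then have i: "i < n" by simp
    show "norm (N (A i)) - e \<le> N (B i) w"
      using v(2)[of i] K(3)[OF i] KW[OF i] Bw[OF i] unfolding B_def by linarith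
  qed
  also have "\<dots> = N (\<Union>i<n. B i) w"
    using B K_disj by (intro vector_measure_finite_UN[OF vector_measure_at, symmetric])
      (auto simp: disjoint_family_on_def B_def)
  also have "\<dots> \<le> norm (N (\<Union>i<n. B i)) * norm w"
    using norm_blinfun[of "N (\<Union>i<n. B i)" w] by simp
  also have "\<dots> \<le> C * 1"
    using \<open>norm w \<le> 1 * 1\<close> B C[of "{}"] by (intro mult_mono C) (auto intro: order_trans[OF norm_ge_zero])
  finally show ?thesis by simp
qed

lemma variation_finite: "variation N UNIV < \<infinity>"
proof -
  obtain C where C: "\<And>B. B \<in> sets borel \<Longrightarrow> norm (N B) \<le> C"
    using vector_measure_bounded[OF vector_measure] by blast
  have "variation N UNIV \<le> ennreal C"
    unfolding variation_def
  proof (rule SUP_least)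
    fix P :: "'a set set" assume P: "P \<in> {P. finite P \<and> P \<subseteq> sets borel \<and> partition_on UNIV P}"
    then obtain A where A: "bij_betw A {..<card P} P"
      using ex_bij_betw_nat_finite[of P] by (auto simp: atLeast0LessThan)
    let ?n = "card P"
    have disj: "disjoint_family_on A {..<?n}"
      unfolding disjoint_family_on_def
    proof (intro ballI impI)
      fix i j assume ij: "i \<in> {..<?n}" "j \<in> {..<?n}" "i \<noteq> j"
      then have "A i \<in> P" "A j \<in> P" "A i \<noteq> A j"
        using A by (auto simp: bij_betw_def inj_on_eq_iff)
      then show "A i \<inter> A j = {}"
        using P by (auto simp: partition_on_def dest: disjointD)
    qed
    have meas: "A i \<in> sets borel" if "i < ?n" for i
      using P bij_betwE[OF A] that by auto
    have "(\<Sum>i<?n. norm (N (A i))) \<le> C"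
    proof (rule field_le_epsilon)
      fix e :: real assume "0 < e"
      \<comment> \<open>The error is shared among the \<open>?n\<close> pieces; adding
        \<open>1\<close> keeps the divisor positive without a separate argument that
        \<open>P\<close> is nonempty.\<close>
      then have "(\<Sum>i<?n. norm (N (A i)) - e / (real ?n + 1)) \<le> C"
        by (intro sum_norm_disjoint_le meas disj C) auto
      then have "(\<Sum>i<?n. norm (N (A i))) \<le> C + real ?n * (e / (real ?n + 1))"
        by (simp add: sum_subtractf)
      also have "real ?n * (e / (real ?n + 1)) \<le> e"
        using \<open>0 < e\<close> by (simp add: field_simps)
      finally show "(\<Sum>i<?n. norm (N (A i))) \<le> C + e" by simp
    qed
    then have "(\<Sum>E\<in>P. norm (N E)) \<le> C"
      using sum.reindex_bij_betw[OF A, of "\<lambda>E. norm (N E)"] by simp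
    then show "(\<Sum>A\<in>P. ennreal (norm (N A))) \<le> ennreal C"
      by (simp add: ennreal_leI)
  qed
  then show ?thesis by (simp add: order_le_less_trans)
qed

sublocale total: finite_measure "total_variation N"
  by (rule finite_measure_total_variation[OF vector_measure variation_finite])

lemma norm_le_total_variation:
  assumes "B \<in> sets borel"
  shows "norm (N B) \<le> measure (total_variation N) B"
  using norm_le_variation[of B N] assms vector_measure_empty[OF vector_measure]
    emeasure_total_variation[OF vector_measure assms, symmetric]
  by (simp add: total.emeasure_eq_measure)

text \<open>On \<open>B \<inter> W k\<close> the vector \<open>v\<close> may be replaced by
  \<open>act (g k) v\<close>, whose norm the local seminorm bounds; continuity from below then
  recovers \<open>B\<close>.\<close>

lemma abs_measure_le_local_seminorm:
  assumes A: "open A" and B: "B \<in> sets borel" "B \<subseteq> A"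
  shows "\<bar>N B v\<bar> \<le> measure (total_variation N) B * local_seminorm R act A v"
proof -
  obtain g W where gW: "\<And>k. g k \<in> R" "\<And>k. bcontfun_supp (g k) \<subseteq> A" "\<And>k. norm (g k) \<le> 1"
    "\<And>k. open (W k)" "\<And>k x. x \<in> W k \<Longrightarrow> g k x = 1" "incseq W" "(\<Union>k. W k) = A"
    using cutoffs_exist[OF A] by metis
  have BW: "B \<inter> W k \<in> sets borel" for k using B gW(4) by auto
  have bound: "\<bar>N (B \<inter> W k) v\<bar> \<le> measure (total_variation N) B * local_seminorm R act A v" for k
  proof -
    have "N (B \<inter> W k) v = N (B \<inter> W k) (act (g k) v)"
      using measure_act_cutoff[OF gW(4,1,5) BW] by simp
    also have "\<bar>\<dots>\<bar> \<le> norm (N (B \<inter> W k)) * norm (act (g k) v)"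
      using norm_blinfun[of "N (B \<inter> W k)" "act (g k) v"] by simp
    also have "\<dots> \<le> measure (total_variation N) B * local_seminorm R act A v"
    proof (rule mult_mono)
      show "norm (N (B \<inter> W k)) \<le> measure (total_variation N) B"
        by (rule order_trans[OF norm_le_total_variation[OF BW] total.finite_measure_mono]) (use B in auto)
      show "norm (act (g k) v) \<le> local_seminorm R act A v"
        by (intro norm_act_le_local_seminorm gW)
    qed auto
    finally show ?thesis .
  qed
  have "(\<lambda>k. N (B \<inter> W k) v) \<longlonglongrightarrow> N (\<Union>k. B \<inter> W k) v"
    by (rule vector_measure_incseq[OF vector_measure_at BW]) (use gW(6) in \<open>auto simp: incseq_Suc_iff\<close>)
  moreover have "(\<Union>k. B \<inter> W k) = B" using gW(7) B by (simp add: Int_absorb2)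
  ultimately have "(\<lambda>k. \<bar>N (B \<inter> W k) v\<bar>) \<longlonglongrightarrow> \<bar>N B v\<bar>"
    by (simp add: tendsto_rabs)
  then show ?thesis by (rule LIMSEQ_le_const2) (use bound in auto)
qed

end

section \<open>Existence and properties of the polar decomposition\<close>

text \<open>On the set where \<open>f\<close> exceeds \<open>g\<close>, a positive function has
  nonpositive integral, which forces that set to be null.\<close>

lemma AE_le_of_set_integral_le:
  fixes f g :: "'a \<Rightarrow> real"
  assumes f: "integrable M f" and g: "integrable M g"
    and le: "\<And>A. A \<in> sets M \<Longrightarrow> (LINT x:A|M. f x) \<le> (LINT x:A|M. g x)"
  shows "AE x in M. f x \<le> g x"
proof -
  have [measurable]: "f \<in> borel_measurable M" "g \<in> borel_measurable M" using f g by auto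
  define A where "A = {x \<in> space M. g x < f x}"
  have A: "A \<in> sets M" unfolding A_def by measurable
  have int: "set_integrable M A f" "set_integrable M A g"
    by (rule integrable_imp_set_integrable; fact)+
  have "(LINT x:A|M. f x - g x) = (LINT x:A|M. f x) - (LINT x:A|M. g x)"
    by (rule set_integral_diff(2)[OF int])
  also have "\<dots> \<le> 0" using le[OF A] by simp
  finally have "(LINT x:A|M. f x - g x) \<le> 0" .
  moreover have "0 \<le> (LINT x:A|M. f x - g x)"
    unfolding set_lebesgue_integral_def
    by (rule integral_nonneg_AE) (auto simp: A_def split: split_indicator)
  ultimately have "A \<in> null_sets M"
    using null_if_pos_func_has_zero_int[of M "\<lambda>x. f x - g x" A] A f g by (auto simp: A_def)
  then have "AE x in M. x \<notin> A" by (rule AE_not_in)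
  then show ?thesis unfolding A_def by auto
qed

text \<open>Adding \<open>C\<close> times \<open>M\<close> turns \<open>\<nu>\<close> into a
  nonnegative finite measure, absolutely continuous with respect to \<open>M\<close>. The usual
  Radon-Nikodym theorem applies to it, and subtracting \<open>C\<close> from the density undoes the
  shift.\<close>

lemma bounded_signed_density:
  fixes \<nu> :: "'a::topological_space set \<Rightarrow> real"
  assumes M: "sets M = sets borel" "finite_measure M"
    and \<nu>: "vector_measure \<nu>" and bound: "\<And>B. B \<in> sets borel \<Longrightarrow> \<bar>\<nu> B\<bar> \<le> C * measure M B" and "0 \<le> C"
  obtains f where "integrable M f" "\<And>x. \<bar>f x\<bar> \<le> C" "\<And>B. B \<in> sets borel \<Longrightarrow> \<nu> B = (LINT x:B|M. f x)"
proof -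
  interpret finite_measure M by fact
  note [measurable_cong] = M(1)
  have space: "space M = UNIV" using sets_eq_imp_space_eq[OF M(1)] by simp
  define \<kappa> where "\<kappa> B = \<nu> B + C * measure M B" for B
  have \<kappa>_nonneg: "0 \<le> \<kappa> B" if "B \<in> sets borel" for B
    using bound[OF that] by (simp add: \<kappa>_def abs_le_iff)
  define K where "K = measure_of UNIV (sets borel) (\<lambda>B. ennreal (\<kappa> B))"
  have sets_K: "sets K = sets borel"
    unfolding K_def by (metis sets.sets_measure_of_eq space_borel)
  have K: "emeasure K B = ennreal (\<kappa> B)" if "B \<in> sets borel" for B
  proof (rule emeasure_measure_of[OF K_def])
    show "positive (sets K) (\<lambda>B. ennreal (\<kappa> B))"
      by (simp add: positive_def \<kappa>_def vector_measure_empty[OF \<nu>])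
    show "countably_additive (sets K) (\<lambda>B. ennreal (\<kappa> B))"
    proof (rule countably_additiveI)
      fix A :: "nat \<Rightarrow> 'a set"
      assume A: "range A \<subseteq> sets K" "disjoint_family A" "(\<Union>i. A i) \<in> sets K"
      have "(\<lambda>i. \<kappa> (A i)) sums \<kappa> (\<Union>i. A i)"
        unfolding \<kappa>_def using A sets_K M(1)
        by (intro sums_add sums_mult finite_measure_UNION vector_measure_sums[OF \<nu>]) auto
      then show "(\<Sum>i. ennreal (\<kappa> (A i))) = ennreal (\<kappa> (\<Union>i. A i))"
        using A sets_K by (intro suminf_ennreal_eq \<kappa>_nonneg) auto
    qed
  qed (use that sets_K in auto)
  interpret K: finite_measure K
    by (rule finite_measureI) (use K sets_eq_imp_space_eq[OF sets_K] in simp)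
  have ac: "absolutely_continuous M K"
    unfolding absolutely_continuous_def
  proof
    fix B assume B: "B \<in> null_sets M"
    then have "B \<in> sets borel" "measure M B = 0" using M(1) by (auto simp: null_sets_def measure_def)
    then show "B \<in> null_sets K" using bound[of B] by (auto simp: K \<kappa>_def sets_K)
  qed
  obtain D where D: "D \<in> borel_measurable M" "AE x in M. RN_deriv M K x = ennreal (D x)" "\<And>x. 0 \<le> D x"
    using real_RN_deriv[OF K.finite_measure_axioms ac] sets_K M(1) by metis
  have dens: "emeasure K B = (\<integral>\<^sup>+x. ennreal (indicator B x * D x) \<partial>M)" if B: "B \<in> sets borel" for B
  proof -
    have "K = density M (RN_deriv M K)"
      using density_RN_deriv[OF ac] sets_K M(1) by simp
    also have "\<dots> = density M (\<lambda>x. ennreal (D x))"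
      by (rule density_cong) (use D in auto)
    finally have "emeasure K B = emeasure (density M (\<lambda>x. ennreal (D x))) B" by simp
    also have "\<dots> = (\<integral>\<^sup>+x. ennreal (D x) * indicator B x \<partial>M)"
      using B M(1) D by (intro emeasure_density) auto
    also have "\<dots> = (\<integral>\<^sup>+x. ennreal (indicator B x * D x) \<partial>M)"
      by (rule nn_integral_cong) (simp split: split_indicator)
    finally show ?thesis .
  qed
  have D_int: "integrable M D"
  proof (rule integrableI_nonneg)
    show "(\<integral>\<^sup>+x. D x \<partial>M) < \<infinity>" using dens[of UNIV] K[of UNIV] by (simp flip: dens[of UNIV, simplified])
  qed (use D in auto)
  have D_set_int: "integrable M (\<lambda>x. indicat_real B x * D x)" if "B \<in> sets borel" for B
    using integrable_mult_indicator[of B M D] D_int M(1) that by simp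
  have D_eq: "(LINT x:B|M. D x) = \<kappa> B" if B: "B \<in> sets borel" for B
  proof -
    have "ennreal (\<kappa> B) = ennreal (\<integral>x. indicat_real B x * D x \<partial>M)"
      using K[OF B] dens[OF B] nn_integral_eq_integral[OF D_set_int[OF B]] D(3) by simp
    then show ?thesis
      using \<kappa>_nonneg[OF B] D(3) by (simp add: set_lebesgue_integral_def)
  qed
  define g where "g x = D x - C" for x
  have g_int: "integrable M g" unfolding g_def using D_int by simp
  have set_int: "set_integrable M B h" if "B \<in> sets borel" "integrable M h" for B and h :: "'a \<Rightarrow> real"
    using that M(1) by (intro integrable_imp_set_integrable) auto
  have const: "(LINT x:B|M. r) = r * measure M B" if "B \<in> sets borel" for B and r :: real
    using that M(1) space by (simp add: set_lebesgue_integral_def)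
  have g_eq: "(LINT x:B|M. g x) = \<nu> B" if B: "B \<in> sets borel" for B
    unfolding g_def using set_int[OF B] D_int
    by (subst set_integral_diff) (auto simp: D_eq[OF B] const[OF B] \<kappa>_def)
  have "AE x in M. g x \<le> C" "AE x in M. - C \<le> g x"
    using bound M(1) g_int by (auto intro!: AE_le_of_set_integral_le simp: g_eq const abs_le_iff)
      (smt (verit) bound)+
  then have clamp: "AE x in M. g x = max (- C) (min C (g x))"
    by eventually_elim auto
  \<comment> \<open>The bound for \<open>g\<close> holds only almost everywhere; truncation makes it
    hold at every point, as the convergence of cell averages requires.\<close>
  define f where "f x = max (- C) (min C (g x))" for x
  have [measurable]: "g \<in> borel_measurable M" using g_int by auto
  have f_meas: "f \<in> borel_measurable M" unfolding f_def by measurable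
  show thesis
  proof (rule that)
    show "integrable M f"
      using g_int clamp f_meas unfolding f_def by (subst integrable_cong_AE[where g=g]) auto
    show "\<bar>f x\<bar> \<le> C" for x using \<open>0 \<le> C\<close> by (auto simp: f_def)
    show "\<nu> B = (LINT x:B|M. f x)" if B: "B \<in> sets borel" for B
      unfolding g_eq[OF B, symmetric] set_lebesgue_integral_def
      using clamp f_meas B by (intro integral_cong_AE) (auto simp: f_def)
  qed
qed

text \<open>A set that differs from a measurable one by a null set is measurable for the
  completion.\<close>

lemma borel_measurable_completion_cong_AE:
  assumes g: "g \<in> borel_measurable M" and eq: "AE x in M. f x = g x"
  shows "f \<in> borel_measurable (completion M)"
proof (rule measurableI)
  fix A :: "'b set" assume A: "A \<in> sets borel"
  show "f -` A \<inter> space (completion M) \<in> sets (completion M)"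
  proof (rule completion.in_sets_AE)
    show "AE x in completion M. x \<in> g -` A \<inter> space M \<longleftrightarrow> x \<in> f -` A \<inter> space (completion M)"
      using AE_completion[OF eq] by eventually_elim auto
    show "g -` A \<inter> space M \<in> sets (completion M)"
      using measurable_sets[OF g A] by simp
  qed simp
qed simp

text \<open>Measurability for the completion is weaker than for \<open>M\<close>; these equivalences
  transfer integrals to an \<open>M\<close>-measurable representative.\<close>

lemma
  fixes f g :: "'a \<Rightarrow> real"
  assumes g: "g \<in> borel_measurable M" and f: "f \<in> borel_measurable (completion M)"
    and eq: "AE x in M. f x = g x"
  shows integrable_completion_cong_AE: "integrable (completion M) f \<longleftrightarrow> integrable M g"
    and set_integral_completion_cong_AE:
      "A \<in> sets M \<Longrightarrow> (LINT x:A|completion M. f x) = (LINT x:A|M. g x)"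
proof -
  have gc: "g \<in> borel_measurable (completion M)" using g by (rule measurable_completion)
  note eqc = AE_completion[OF eq]
  show "integrable (completion M) f \<longleftrightarrow> integrable M g"
    using integrable_cong_AE[OF f gc eqc] integrable_completion[OF g] by simp
  show "(LINT x:A|completion M. f x) = (LINT x:A|M. g x)" if A: "A \<in> sets M"
  proof -
    have Ac: "A \<in> sets (completion M)" using A by simp
    have "(LINT x:A|completion M. f x) = (LINT x:A|completion M. g x)"
      unfolding set_lebesgue_integral_def using f gc Ac eqc by (intro integral_cong_AE) auto
    also have "\<dots> = (LINT x:A|M. g x)"
      unfolding set_lebesgue_integral_def using g A by (intro integral_completion) auto
    finally show ?thesis .
  qed
qed

text \<open>Once one density exists, the chosen function is a density too, and integrable functions
  with equal integrals over all measurable sets agree almost everywhere.\<close>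

lemma signed_RN_deriv_AE_eq:
  assumes f: "integrable M f" "\<And>B. B \<in> sets M \<Longrightarrow> \<nu> B = (LINT x:B|M. f x)"
  shows "AE x in M. f x = signed_RN_deriv M \<nu> x"
proof -
  have "\<exists>f. integrable M f \<and> (\<forall>B\<in>sets M. \<nu> B = (LINT x:B|M. f x))" using f by blast
  from someI_ex[OF this] have "integrable M (signed_RN_deriv M \<nu>)"
    "\<forall>B\<in>sets M. \<nu> B = (LINT x:B|M. signed_RN_deriv M \<nu> x)"
    unfolding signed_RN_deriv_def by blast+
  then show ?thesis using f by (intro density_unique_real) auto
qed

section \<open>Uniqueness, essential supremum and existence\<close>

context local_measure
begin

abbreviation \<mu> :: "'a measure" where
  "\<mu> \<equiv> total_variation N"

lemma abs_measure_le: "B \<in> sets borel \<Longrightarrow> \<bar>N B v\<bar> \<le> norm v * measure \<mu> B"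
  using abs_measure_le_local_seminorm[of UNIV B v]
    mult_left_mono[OF local_seminorm_le_norm[of UNIV v] measure_nonneg[of \<mu> B]]
  by (simp add: mult.commute)

lemma polar_decomposition_density:
  assumes L: "polar_decomposition R act N L"
  obtains f where "integrable \<mu> f" "\<And>B. B \<in> sets borel \<Longrightarrow> N B v = (LINT x:B|\<mu>. f x)"
    "AE x in \<mu>. L x v = f x"
proof -
  have meas: "(\<lambda>x. L x v) \<in> borel_measurable (completion \<mu>)"
    and int: "integrable (completion \<mu>) (\<lambda>x. L x v)"
    and eq: "\<And>A. A \<in> sets borel \<Longrightarrow> N A v = (LINT x:A|completion \<mu>. L x v)"
    using L unfolding polar_decomposition_def by auto
  obtain f where f: "f \<in> borel_measurable \<mu>" "AE x in \<mu>. L x v = f x"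
    using completion_ex_borel_measurable_real[OF meas] by blast
  show thesis
  proof (rule that)
    show "integrable \<mu> f" using integrable_completion_cong_AE[OF f(1) meas f(2)] int by simp
    show "N B v = (LINT x:B|\<mu>. f x)" if "B \<in> sets borel" for B
      using set_integral_completion_cong_AE[OF f(1) meas f(2)] eq that by simp
  qed fact
qed

lemma polar_decomposition_AE_eq_RN_deriv:
  assumes "polar_decomposition R act N L"
  shows "AE x in \<mu>. L x v = signed_RN_deriv \<mu> (\<lambda>B. N B v) x"
proof -
  obtain f where f: "integrable \<mu> f" "\<And>B. B \<in> sets borel \<Longrightarrow> N B v = (LINT x:B|\<mu>. f x)"
    "AE x in \<mu>. L x v = f x"
    using polar_decomposition_density[OF assms] by blast
  have "AE x in \<mu>. f x = signed_RN_deriv \<mu> (\<lambda>B. N B v) x"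
    by (rule signed_RN_deriv_AE_eq) (use f in auto)
  with f(3) show ?thesis by eventually_elim simp
qed

text \<open>That \<open>1\<close> is an upper bound follows at every point, since the germ seminorm
  is at most the norm. Minimality holds because the norms of \<open>N\<close> over finite partitions
  recover the whole variation.\<close>

lemma polar_decomposition_ess_sup:
  assumes L: "polar_decomposition R act N L"
  shows "is_ess_sup \<mu> {v. norm v \<le> 1} (\<lambda>v x. ereal (L x v)) (\<lambda>x. 1)"
  unfolding is_ess_sup_def
proof (intro conjI ballI impI)
  fix v :: 'v assume v: "v \<in> {v. norm v \<le> 1}"
  have "L x v \<le> 1" for x
    using L germ_seminorm_le_norm[of v x] v unfolding polar_decomposition_def
    by (smt (verit) mem_Collect_eq)
  then show "AE x in \<mu>. ereal (L x v) \<le> 1" by simp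
next
  fix h :: "'a \<Rightarrow> ereal"
  assume h[measurable]: "h \<in> borel_measurable (completion \<mu>)"
    and ub: "\<forall>v\<in>{v. norm v \<le> 1}. AE x in \<mu>. ereal (L x v) \<le> h x"
  have gt: "AE x in \<mu>. ereal r < h x" if "r < 1" for r
  proof -
    define S where "S = {x \<in> space (completion \<mu>). h x \<le> ereal r}"
    have "S \<in> sets (completion \<mu>)" unfolding S_def by measurable
    \<comment> \<open>\<open>S\<close> is measurable only for the completion. The variation is
      computed on its Borel part \<open>E\<close>; the rest lies in a null set.\<close>
    then obtain E Z Z' where EZ: "S = E \<union> Z" "Z \<subseteq> Z'" "Z' \<in> null_sets \<mu>" "E \<in> sets \<mu>"
      by (rule sets_completionE)
    have E: "E \<in> sets borel" using EZ by simp
    have norm_le: "norm (N B) \<le> r * measure \<mu> B" if B: "B \<in> sets borel" "B \<subseteq> E" for B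
    proof (rule norm_le_of_unit_ball_bound)
      fix v :: 'v assume v: "norm v \<le> 1"
      obtain f where f: "integrable \<mu> f" "\<And>B. B \<in> sets borel \<Longrightarrow> N B v = (LINT x:B|\<mu>. f x)"
        "AE x in \<mu>. L x v = f x"
        using polar_decomposition_density[OF L] by blast
      have "AE x in \<mu>. ereal (L x v) \<le> h x" using ub v by simp
      with f(3) have le: "AE x\<in>B in \<mu>. f x \<le> r"
      proof eventually_elim
        case (elim x)
        show ?case
        proof
          assume "x \<in> B"
          then have "h x \<le> ereal r" using B EZ(1) by (auto simp: S_def)
          with elim have "ereal (f x) \<le> ereal r" by (metis order_trans)
          then show "f x \<le> r" by simp
        qed
      qed
      have "N B v = (LINT x:B|\<mu>. f x)" using f B by simp
      also have "\<dots> \<le> (LINT x:B|\<mu>. r)"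
        using le B f(1) by (intro set_integral_mono_AE integrable_imp_set_integrable) auto
      also have "\<dots> = r * measure \<mu> B"
        using B by (simp add: set_lebesgue_integral_def)
      finally show "N B v \<le> r * measure \<mu> B" .
    qed
    have "variation N E \<le> ennreal (r * measure \<mu> E)"
      unfolding variation_def
    proof (rule SUP_least)
      fix P :: "'a set set" assume P: "P \<in> {P. finite P \<and> P \<subseteq> sets borel \<and> partition_on E P}"
      have "(\<Sum>A\<in>P. norm (N A)) \<le> (\<Sum>A\<in>P. r * measure \<mu> A)"
        using P by (intro sum_mono norm_le) (auto simp: partition_on_def)
      also have "\<dots> = r * measure \<mu> (\<Union>A\<in>P. A)"
        using P by (subst total.finite_measure_finite_Union)
          (auto simp: sum_distrib_left partition_on_def disjoint_family_on_def disjoint_def)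
      also have "(\<Union>A\<in>P. A) = E" using P by (auto simp: partition_on_def)
      finally show "(\<Sum>A\<in>P. ennreal (norm (N A))) \<le> ennreal (r * measure \<mu> E)"
        by (simp add: ennreal_leI)
    qed
    then have "ennreal (measure \<mu> E) \<le> ennreal (r * measure \<mu> E)"
      using emeasure_total_variation[OF vector_measure E] by (simp add: total.emeasure_eq_measure)
    moreover have "r * measure \<mu> E < measure \<mu> E" if "measure \<mu> E > 0"
      using that \<open>r < 1\<close> by simp
    ultimately have "measure \<mu> E = 0"
      by (smt (verit) ennreal_lessI linorder_not_le zero_less_measure_iff)
    then have "E \<in> null_sets \<mu>" using E by (auto simp: total.emeasure_eq_measure)
    then have "E \<union> Z' \<in> null_sets \<mu>" using EZ by auto
    then have "AE x in \<mu>. x \<notin> E \<union> Z'" by (rule AE_not_in)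
    then show ?thesis
    proof eventually_elim
      case (elim x)
      then have "x \<notin> S" using EZ by auto
      then show ?case by (simp add: S_def)
    qed
  qed
  \<comment> \<open>Rational levels leave only countably many null sets, and a value of
    \<open>h\<close> below \<open>1\<close> would have a rational between it and
    \<open>1\<close>.\<close>
  have "AE x in \<mu>. \<forall>q\<in>{q::rat. real_of_rat q < 1}. ereal (real_of_rat q) < h x"
    by (subst AE_ball_countable) (use gt in auto)
  then show "AE x in \<mu>. 1 \<le> h x"
  proof eventually_elim
    case (elim x)
    show ?case
    proof (rule ccontr)
      assume "\<not> 1 \<le> h x"
      then obtain q :: rat where "h x < real_of_rat q" "real_of_rat q < (1::ereal)"
        using ereal_dense3[of "h x" 1] by (auto simp: not_le)
      then show False using elim by (auto simp: not_less[symmetric])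
    qed
  qed
qed simp

text \<open>No countable family of test vectors is available, so the Radon--Nikodym densities cannot be
  made linear in \<open>v\<close> by discarding a null set: hence the ultrafilter limit at every point.\<close>

lemma polar_decomposition_exists: "\<exists>L. polar_decomposition R act N L"
proof -
  obtain c :: "nat \<Rightarrow> 'a \<Rightarrow> nat list" where c: "\<And>n. c n \<in> measurable borel (count_space UNIV)"
    "\<And>n x. length (c n x) = n" "\<And>m n x y. m \<le> n \<Longrightarrow> c n x = c n y \<Longrightarrow> c m x = c m y"
    "\<And>x A. open A \<Longrightarrow> x \<in> A \<Longrightarrow> \<forall>\<^sub>F n in sequentially. {y. c n y = c n x} \<subseteq> A"
    using refining_partitions_exist by blast
  interpret shrinking_partitions c by unfold_locales (fact c)+
  obtain U :: "nat filter" where U: "U \<le> sequentially" "U \<noteq> bot"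
    and ultra: "\<And>P. eventually P U \<or> eventually (\<lambda>n. \<not> P n) U"
    using ultrafilter_exists[OF sequentially_bot] by blast
  define q where "q n x v = N (cell n x) v / measure \<mu> (cell n x)" for n x v
  \<comment> \<open>On a cell of measure zero the quotient is \<open>0\<close> by the convention for
    division, so the bound holds at every point.\<close>
  have q_le: "\<bar>q n x v\<bar> \<le> s" if "\<bar>N (cell n x) v\<bar> \<le> s * measure \<mu> (cell n x)" "0 \<le> s" for n x v s
    using that by (cases "measure \<mu> (cell n x) = 0") (auto simp: q_def divide_le_eq zero_less_measure_iff)
  define l where "l x v = Lim U (\<lambda>n. q n x v)" for x v
  have lim: "((\<lambda>n. q n x v) \<longlongrightarrow> l x v) U" for x v
  proof -
    have "q n x v \<in> {- norm v..norm v}" for n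
      using q_le[OF abs_measure_le[OF cell_borel]] by (auto simp: abs_le_iff minus_le_iff)
    then obtain s where "((\<lambda>n. q n x v) \<longlongrightarrow> s) U"
      using ultrafilter_tendsto_compact[OF U(2) ultra, of "{- norm v..norm v}" "\<lambda>n. q n x v"] by auto
    with tendsto_Lim[OF U(2) this] show ?thesis by (simp add: l_def)
  qed
  have lim_le: "\<bar>l x v\<bar> \<le> s" if "\<forall>\<^sub>F n in sequentially. \<bar>q n x v\<bar> \<le> s" for x v s
    by (rule tendsto_upperbound[OF tendsto_rabs[OF lim] filter_leD[OF U(1) that] U(2)])
  \<comment> \<open>One ultrafilter serves all vectors, so linearity of the quotients passes to the
    limit with no exceptional set.\<close>
  have "bounded_linear (l x)" for x
  proof (rule bounded_linear_intro[where K = 1])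
    show "l x (v + w) = l x v + l x w" for v w
    proof (rule tendsto_unique[OF U(2) lim])
      show "((\<lambda>n. q n x (v + w)) \<longlongrightarrow> l x v + l x w) U"
        using tendsto_add[OF lim lim, of x v x w]
        by (simp add: q_def blinfun.add_right add_divide_distrib)
    qed
    show "l x (r *\<^sub>R v) = r *\<^sub>R l x v" for r v
    proof (rule tendsto_unique[OF U(2) lim])
      show "((\<lambda>n. q n x (r *\<^sub>R v)) \<longlongrightarrow> r *\<^sub>R l x v) U"
        using tendsto_mult_left[OF lim, of r x v] by (simp add: q_def blinfun.scaleR_right)
    qed
    show "norm (l x v) \<le> norm v * 1" for v
      using lim_le[of x v "norm v"] q_le[OF abs_measure_le[OF cell_borel]] by simp
  qed
  then have L: "blinfun_apply (Blinfun (l x)) = l x" for x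
    by (rule bounded_linear_Blinfun_apply)
  \<comment> \<open>The cell averages converge almost everywhere in the ordinary sense, hence along
    \<open>U\<close> to the same value; the null set may depend on \<open>v\<close>, which is
    harmless here.\<close>
  have dens: "\<exists>f. integrable \<mu> f \<and> (\<forall>B\<in>sets borel. N B v = (LINT x:B|\<mu>. f x)) \<and> (AE x in \<mu>. l x v = f x)" for v
  proof -
    obtain f where f: "integrable \<mu> f" "\<And>x. \<bar>f x\<bar> \<le> norm v" "\<And>B. B \<in> sets borel \<Longrightarrow> N B v = (LINT x:B|\<mu>. f x)"
      using bounded_signed_density[OF sets_total_variation total.finite_measure_axioms
          vector_measure_at[of v] abs_measure_le[of _ v] norm_ge_zero] by blast
    have "AE x in \<mu>. (\<lambda>n. (LINT y:cell n x|\<mu>. f y) / measure \<mu> (cell n x)) \<longlonglongrightarrow> f x"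
      by (rule cell_average_tendsto[OF sets_total_variation total.finite_measure_axioms f(1,2)])
    then have "AE x in \<mu>. l x v = f x"
    proof eventually_elim
      case (elim x)
      then have "(\<lambda>n. q n x v) \<longlonglongrightarrow> f x" by (simp add: q_def f(3))
      then have "((\<lambda>n. q n x v) \<longlongrightarrow> f x) U" by (rule tendsto_mono[OF U(1)])
      then show ?case by (rule tendsto_unique[OF U(2) lim])
    qed
    with f show ?thesis by blast
  qed
  have "polar_decomposition R act N (\<lambda>x. Blinfun (l x))"
    unfolding polar_decomposition_def L
  proof (intro conjI allI ballI)
    fix v
    obtain f where f: "integrable \<mu> f" "\<And>B. B \<in> sets borel \<Longrightarrow> N B v = (LINT x:B|\<mu>. f x)"
      "AE x in \<mu>. l x v = f x"
      using dens by blast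
    have f_meas: "f \<in> borel_measurable \<mu>" using f(1) by auto
    show meas: "(\<lambda>x. l x v) \<in> borel_measurable (completion \<mu>)"
      by (rule borel_measurable_completion_cong_AE[OF f_meas f(3)])
    show "integrable (completion \<mu>) (\<lambda>x. l x v)"
      using integrable_completion_cong_AE[OF f_meas meas f(3)] f(1) by simp
    show "N A v = (LINT x:A|completion \<mu>. l x v)" if "A \<in> sets borel" for A
      using set_integral_completion_cong_AE[OF f_meas meas f(3)] f(2) that by simp
  next
    fix x v
    show "\<bar>l x v\<bar> \<le> germ_seminorm R act v x"
      unfolding germ_seminorm_def
    proof (rule cINF_greatest)
      show "{A. open A \<and> x \<in> A} \<noteq> {}" by auto
      fix A assume "A \<in> {A. open A \<and> x \<in> A}"
      then have A: "open A" "x \<in> A" by auto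
      \<comment> \<open>All but finitely many cells around \<open>x\<close> lie inside
        \<open>A\<close>, so their quotients obey the local estimate there.\<close>
      have "\<forall>\<^sub>F n in sequentially. \<bar>q n x v\<bar> \<le> local_seminorm R act A v"
        using cell_eventually_subset[OF A]
      proof eventually_elim
        case (elim n)
        then show ?case
          using abs_measure_le_local_seminorm[OF A(1) cell_borel elim, of v]
          by (intro q_le local_seminorm_nonneg) (simp add: mult.commute)
      qed
      then show "\<bar>l x v\<bar> \<le> local_seminorm R act A v" by (rule lim_le)
    qed
  qed
  then show ?thesis by blast
qed

end

theorem proposition1p21:
  fixes R :: "('a::polish_space \<Rightarrow>\<^sub>C real) set"
    and act :: "('a \<Rightarrow>\<^sub>C real) \<Rightarrow> 'v::real_normed_vector \<Rightarrow> 'v"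
    and N :: "'a set \<Rightarrow> 'v \<Rightarrow>\<^sub>L real"
  assumes "normed_module R act"
    and "local_vector_measure R act N"
  shows "(\<exists>L. polar_decomposition R act N L) \<and>
    (\<forall>L L'. polar_decomposition R act N L \<longrightarrow> polar_decomposition R act N L' \<longrightarrow>
       (\<forall>v. AE x in total_variation N. L x v = L' x v)) \<and>
    (\<forall>L. polar_decomposition R act N L \<longrightarrow>
       (\<forall>v. AE x in total_variation N.
          L x v = signed_RN_deriv (total_variation N) (\<lambda>B. N B v) x) \<and>
       is_ess_sup (total_variation N) {v. norm v \<le> 1} (\<lambda>v x. ereal (L x v)) (\<lambda>x. 1))"
proof -
  interpret local_measure R act N
    using assms by unfold_locales
  \<comment> \<open>Both decompositions agree almost everywhere with the same chosen
    derivative.\<close>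
  have "AE x in total_variation N. L x v = L' x v"
    if "polar_decomposition R act N L" "polar_decomposition R act N L'" for L L' v
    using polar_decomposition_AE_eq_RN_deriv[OF that(1), of v]
      polar_decomposition_AE_eq_RN_deriv[OF that(2), of v]
    by eventually_elim simp
  then show ?thesis
    using polar_decomposition_exists polar_decomposition_AE_eq_RN_deriv polar_decomposition_ess_sup
    by blast
qed

end
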